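(* Let $\Omega \subseteq \mathbf{R}^n$, $n \geq 2$, be a bounded open set, let $P_0$ be an $N \times N$ Dirac operator in $\mathbf{R}^n$, and let $V \in L^{\infty}(\Omega)^{N \times N}$. Let $\varphi$ be a smooth real-valued function with $\nabla \varphi \neq 0$ near $\overline{\Omega}$, and assume that $\varphi$ is a limiting Carleman weight for the Laplacian. Then there exist constants $h_0 > 0$ and $C > 0$ such that for all $0 < h \leq h_0$ and all $u \in C^{\infty}_c(\Omega)^N$, $$h \|u\|_{L^2(\Omega)} + h^2 \|\nabla u\|_{L^2(\Omega)} \leq C \, \| e^{\varphi/h}(P_0(hD)+hV)e^{-\varphi/h} u \|_{L^2(\Omega)}.$$
   Context: $D = -i\nabla$ and $h>0$ is a small parameter. A Dirac operator $P_0$ in $\mathbf{R}^n$ is a self-adjoint, homogeneous, first order $N\times N$ matrix operator $P_0(D)$ with constant (complex) coefficients whose square is $-\Delta$. That is, each entry of the matrix $P_0(\xi)$ is of the form $a\cdot \xi$ with $a \in \mathbf{C}^n$, and $P_0(\xi)^2 = |\xi|^2 I_N$, $P_0(\xi)^* = P_0(\xi)$ for all $\xi \in \mathbf{R}^n$; $P_0(hD)$ is obtained by replacing $\xi$ by $hD$. Limiting Carleman weight: $\varphi \in C^\infty(\tilde\Omega;\mathbf{R})$, where $\tilde\Omega$ is an open set with $\Omega \subset\subset \tilde\Omega$, is a limiting Carleman weight for the Laplacian in $\tilde\Omega$ if $\nabla\varphi \neq 0$ in $\tilde\Omega$ and the Poisson bracket $\{a,b\}$ vanishes at all points $(x,\xi)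 \in \tilde\Omega\times\mathbf{R}^n$ where $a=b=0$. Here $a(x,\xi) = |\xi|^2 - |\nabla\varphi(x)|^2$ and $b(x,\xi) = 2\nabla\varphi(x)\cdot\xi$ are the real and imaginary parts of the semiclassical Weyl symbol of $e^{\varphi/h}(-h^2\Delta)e^{-\varphi/h}$, and $\{a,b\} = \nabla_\xi a\cdot\nabla_x b - \nabla_x a\cdot\nabla_\xi b$. *)

theory Defs
  imports "HOL-Analysis.Analysis"
begin

section \<open>Derivatives, smoothness and function spaces\<close>

definition partial :: "'n \<Rightarrow> (real^'n \<Rightarrow> 'b) \<Rightarrow> real^'n \<Rightarrow> 'b::real_normed_vector" where
  "partial k f x = frechet_derivative f (at x) (axis k 1)"

text \<open>For a vector-valued \<open>f\<close> the value is the full Jacobian, and its norm is the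
  Frobenius norm.\<close>
definition grad :: "(real^'n \<Rightarrow> 'b) \<Rightarrow> real^'n \<Rightarrow> 'b::real_normed_vector^'n" where
  "grad f x = (\<chi> k. partial k f x)"

text \<open>\<open>Ck_on\<close> and \<open>smooth_on\<close> are meant for open sets, since the derivatives
  are unrestricted ones.\<close>
primrec Ck_on :: "nat \<Rightarrow> (real^'n) set \<Rightarrow> (real^'n \<Rightarrow> 'b::real_normed_vector) \<Rightarrow> bool" where
  "Ck_on 0 S f = continuous_on S f"
| "Ck_on (Suc m) S f =
     ((\<forall>x\<in>S. f differentiable (at x)) \<and> (\<forall>k. Ck_on m S (partial k f)))"

definition smooth_on :: "(real^'n) set \<Rightarrow> (real^'n \<Rightarrow> 'b::real_normed_vector) \<Rightarrow> bool" where
  "smooth_on S f = (\<forall>m. Ck_on m S f)"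

text \<open>Test functions on \<open>\<Omega>\<close> are identified with their extensions by zero.\<close>
definition test_functions :: "(real^'n) set \<Rightarrow> (real^'n \<Rightarrow> 'b::real_normed_vector) set" where
  "test_functions \<Omega> =
     {u. smooth_on UNIV u \<and> compact (closure {x. u x \<noteq> 0}) \<and> closure {x. u x \<noteq> 0} \<subseteq> \<Omega>}"

text \<open>Elements of \<open>Linfty \<Omega>\<close> are represented by total functions; only the values on
  \<open>\<Omega>\<close> matter.\<close>
definition Linfty :: "(real^'n) set \<Rightarrow> (real^'n \<Rightarrow> complex) set" where
  "Linfty \<Omega> = {f. f \<in> borel_measurable (lebesgue_on \<Omega>) \<and>
                 (\<exists>M. AE x in lebesgue_on \<Omega>. norm (f x) \<le> M)}"

definition L2norm :: "(real^'n) set \<Rightarrow> (real^'n \<Rightarrow> 'b::real_normed_vector) \<Rightarrow> real" where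
  "L2norm \<Omega> f = sqrt (\<integral>x. (norm (f x))\<^sup>2 \<partial>lebesgue_on \<Omega>)"

section \<open>Dirac operators\<close>

text \<open>A homogeneous first order matrix operator \<open>P(D) = \<Sum>k. A k D\<^sub>k\<close> is given by
  its coefficient matrices \<open>A k\<close>, so that the \<open>(i, j)\<close> entry of \<open>P(\<xi>)\<close> is
  \<open>a \<cdot> \<xi>\<close> with \<open>a $ k = A k $ i $ j\<close>.\<close>
definition symbol :: "('n \<Rightarrow> complex^'N^'N) \<Rightarrow> real^'n \<Rightarrow> complex^'N^'N" where
  "symbol A \<xi> = (\<chi> i j. \<Sum>k\<in>UNIV. A k $ i $ j * complex_of_real (\<xi> $ k))"

definition dirac_operator :: "('n::finite \<Rightarrow> complex^'N^'N) \<Rightarrow> bool" where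
  "dirac_operator A \<longleftrightarrow>
     (\<forall>\<xi>::real^'n. symbol A \<xi> ** symbol A \<xi> = mat (complex_of_real ((norm \<xi>)\<^sup>2)) \<and>
                  map_matrix cnj (transpose (symbol A \<xi>)) = symbol A \<xi>)"

text \<open>\<open>P(hD) w\<close> with \<open>D = -i \<nabla>\<close>.\<close>
definition semiclassical_op ::
  "('n \<Rightarrow> complex^'N^'N) \<Rightarrow> real \<Rightarrow> (real^'n \<Rightarrow> complex^'N) \<Rightarrow> real^'n \<Rightarrow> complex^'N" where
  "semiclassical_op A h w x =
     (\<Sum>k\<in>UNIV. A k *v ((- \<i> * complex_of_real h) *s partial k w x))"

text \<open>\<open>e\<^bsup>\<phi>/h\<^esup> (P(hD) + hV) e\<^bsup>-\<phi>/h\<^esup> u\<close>\<close>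
definition conjugated_op ::
  "('n \<Rightarrow> complex^'N^'N) \<Rightarrow> (real^'n \<Rightarrow> complex^'N^'N) \<Rightarrow> (real^'n \<Rightarrow> real) \<Rightarrow> real
     \<Rightarrow> (real^'n \<Rightarrow> complex^'N) \<Rightarrow> real^'n \<Rightarrow> complex^'N" where
  "conjugated_op A V \<phi> h u x =
     (let w = (\<lambda>y. exp (- \<phi> y / h) *\<^sub>R u y)
      in exp (\<phi> x / h) *\<^sub>R (semiclassical_op A h w x + h *\<^sub>R (V x *v w x)))"

section \<open>Limiting Carleman weights\<close>

definition poisson_bracket ::
  "(real^'n \<Rightarrow> real^'n \<Rightarrow> real) \<Rightarrow> (real^'n \<Rightarrow> real^'n \<Rightarrow> real) \<Rightarrow> real^'n \<Rightarrow> real^'n \<Rightarrow> real" where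
  "poisson_bracket a b x \<xi> =
     grad (\<lambda>\<eta>. a x \<eta>) \<xi> \<bullet> grad (\<lambda>y. b y \<xi>) x - grad (\<lambda>y. a y \<xi>) x \<bullet> grad (\<lambda>\<eta>. b x \<eta>) \<xi>"

text \<open>Real and imaginary parts of the semiclassical Weyl symbol of
  \<open>e\<^bsup>\<phi>/h\<^esup> (-h\<^sup>2 \<Delta>) e\<^bsup>-\<phi>/h\<^esup>\<close>.\<close>
definition re_symbol :: "(real^'n \<Rightarrow> real) \<Rightarrow> real^'n \<Rightarrow> real^'n \<Rightarrow> real" where
  "re_symbol \<phi> x \<xi> = (norm \<xi>)\<^sup>2 - (norm (grad \<phi> x))\<^sup>2"

definition im_symbol :: "(real^'n \<Rightarrow> real) \<Rightarrow> real^'n \<Rightarrow> real^'n \<Rightarrow> real" where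
  "im_symbol \<phi> x \<xi> = 2 * (grad \<phi> x \<bullet> \<xi>)"

definition limiting_carleman_weight :: "(real^'n) set \<Rightarrow> (real^'n \<Rightarrow> real) \<Rightarrow> bool" where
  "limiting_carleman_weight U \<phi> \<longleftrightarrow>
     smooth_on U \<phi> \<and> (\<forall>x\<in>U. grad \<phi> x \<noteq> 0) \<and>
     (\<forall>x\<in>U. \<forall>\<xi>. re_symbol \<phi> x \<xi> = 0 \<and> im_symbol \<phi> x \<xi> = 0 \<longrightarrow>
        poisson_bracket (re_symbol \<phi>) (im_symbol \<phi>) x \<xi> = 0)"

end

theory Submission
  imports Defs
begin

text \<open>
  Write \<open>\<gamma>\<^sub>k\<close> for multiplication by the coefficient matrices of the Dirac operator,
  \<open>\<gamma>(a) = \<Sum>k. a\<^sub>k \<gamma>\<^sub>k\<close> and \<open>D = \<Sum>k. \<gamma>\<^sub>k \<partial>\<^sub>k\<close>. With the real part of the Hermitian product, \<open>\<complex>\<^sup>N\<close> is a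
  real Euclidean space on which the \<open>\<gamma>\<^sub>k\<close> are symmetric and satisfy the Clifford relations. Up to the
  factor \<open>-i h\<close> the conjugated operator is \<open>D - h\<^bsup>-1\<^esup> \<gamma>(\<nabla>\<phi>)\<close>, plus the bounded perturbation that comes
  from \<open>V\<close>, so the whole argument can be carried out with real inner products.

  The geometric content of the limiting Carleman condition is that \<open>Y = \<nabla>\<phi> / \<bar>\<nabla>\<phi>\<bar>\<^sup>2\<close> is a conformal
  Killing field (\<open>inverted_grad_conformal\<close>): on vectors orthogonal to \<open>\<nabla>\<phi>\<close> the Hessian of
  \<open>\<phi>\<close> is a multiple of the identity. Spinors can be differentiated along a conformal Killing field by
  \<open>S = Y \<cdot> \<nabla> + c\<close>, where the matrix \<open>c\<close> is built from the first derivatives of \<open>Y\<close>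
  (the spinorial Lie derivative). This \<open>S\<close> is skew-adjoint, its commutators
  with \<open>\<gamma>(Y)\<close> and \<open>D\<close> are \<open>\<sigma> \<gamma>(Y)\<close> and \<open>-\<sigma> D\<close> plus a zero order term, and therefore it commutes with \<open>\<gamma>(Y) D\<close> up to multiplication by a bounded
  matrix (\<open>spin_deriv_cl_dirac\<close>).

  Because \<open>\<gamma>(Y) \<gamma>(\<nabla>\<phi>) = 1\<close>, the equation for \<open>(D - a \<gamma>(\<nabla>\<phi>)) v\<close>, multiplied by \<open>\<gamma>(Y)\<close>, reads
  \<open>g = \<gamma>(Y) D v - a v\<close>. Pair it with \<open>S v\<close> and integrate. Skew-adjointness turns the term with \<open>a\<close> into
  \<open>1/2 \<integral> (Y \<cdot> \<nabla>a) \<bar>v\<bar>\<^sup>2\<close>, and the commutation property turns the other one into \<open>\<integral> \<bar>S v\<bar>\<^sup>2\<close> up to errors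
  \<open>O(\<parallel>v\<parallel>\<^sup>2 + \<parallel>v\<parallel> \<parallel>S v\<parallel>)\<close>. When \<open>Y \<cdot> \<nabla>a\<close> is a constant \<open>\<kappa>\<close>, this gives
  \<open>(\<kappa> - C) \<parallel>v\<parallel>\<^sup>2 \<le> \<parallel>g\<parallel>\<^sup>2\<close> with \<open>C\<close> independent of \<open>a\<close> (\<open>carleman_estimate\<close>).

  The choice \<open>a = 1/h + \<kappa> \<phi>\<close> is the convexification of the weight: it belongs to
  \<open>v = exp (\<kappa> \<phi>\<^sup>2 / 2) u\<close>, and the extra factor lies between two positive constants on \<open>\<Omega>\<close> that do not
  depend on \<open>h\<close>. Since \<open>\<kappa>\<close> may be as large as one likes, the contribution of \<open>V\<close> is absorbed, which proves
  the bound for \<open>h \<parallel>u\<parallel>\<close>. For the gradient, \<open>D\<^sup>2 = \<Delta>\<close> yields \<open>\<parallel>\<nabla>u\<parallel> = \<parallel>Du\<parallel>\<close>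
  (\<open>integral_norm_grad_eq_dirac\<close>), and \<open>h Du\<close> differs from the conjugated operator, up to a
  unimodular factor, by bounded multiples of \<open>u\<close>.
\<close>

section \<open>Calculus with partial derivatives\<close>

lemma partial_unique:
  "(f has_derivative D) (at x) \<Longrightarrow> partial k f x = D (axis k 1)"
  unfolding partial_def by (metis frechet_derivative_at)

lemma has_derivative_partial:
  fixes f :: "real^'n \<Rightarrow> 'b::real_normed_vector"
  assumes "f differentiable (at x)"
  shows "(f has_derivative (\<lambda>v. \<Sum>k\<in>UNIV. v $ k *\<^sub>R partial k f x)) (at x)"
proof -
  obtain D where D: "(f has_derivative D) (at x)"
    using assms unfolding differentiable_def by blast
  have "linear D"
    using D has_derivative_linear by blast
  have "D v = (\<Sum>k\<in>UNIV. v $ k *\<^sub>R partial k f x)" for v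
  proof -
    have "D v = D (\<Sum>k\<in>UNIV. v $ k *\<^sub>R axis k 1)"
      by (simp add: basis_expansion flip: scalar_mult_eq_scaleR)
    also have "\<dots> = (\<Sum>k\<in>UNIV. v $ k *\<^sub>R D (axis k 1))"
      using \<open>linear D\<close> by (simp add: linear_sum linear_cmul)
    finally show ?thesis
      using partial_unique[OF D] by simp
  qed
  then show ?thesis
    using D by presburger
qed

lemma partial_cong_open:
  assumes "open S" "x \<in> S" "\<And>y. y \<in> S \<Longrightarrow> f y = g y"
  shows "partial k f x = partial k g x"
proof -
  have "(f has_derivative D) (at x) \<longleftrightarrow> (g has_derivative D) (at x)" for D
    using assms has_derivative_transform_within_open[of _ D x UNIV S] by metis
  then show ?thesis
    unfolding partial_def frechet_derivative_def by simp
qed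

lemma differentiable_cong_open:
  assumes "open S" "x \<in> S" "\<And>y. y \<in> S \<Longrightarrow> f y = g y" "f differentiable (at x)"
  shows "g differentiable (at x)"
  using assms has_derivative_transform_within_open[of f _ x UNIV S g]
  unfolding differentiable_def by metis

lemma partial_const [simp]: "partial k (\<lambda>x. c) x = 0"
  by (subst partial_unique[of _ "\<lambda>h. 0"]) auto

lemma partial_add:
  assumes "f differentiable (at x)" "g differentiable (at x)"
  shows "partial k (\<lambda>y. f y + g y) x = partial k f x + partial k g x"
  using partial_unique[OF has_derivative_add[OF assms[THEN has_derivative_partial]]]
    partial_unique[OF assms(1)[THEN has_derivative_partial]]
    partial_unique[OF assms(2)[THEN has_derivative_partial]] by metis

lemma partial_sum:
  assumes "\<And>i. i \<in> I \<Longrightarrow> f i differentiable (at x)"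
  shows "partial k (\<lambda>y. \<Sum>i\<in>I. f i y) x = (\<Sum>i\<in>I. partial k (f i) x)"
proof -
  have "((\<lambda>y. \<Sum>i\<in>I. f i y) has_derivative (\<lambda>h. \<Sum>i\<in>I. frechet_derivative (f i) (at x) h)) (at x)"
    by (rule has_derivative_sum) (use assms frechet_derivative_works in blast)
  from partial_unique[OF this] show ?thesis
    by (simp add: partial_def)
qed

lemma partial_linear:
  assumes "bounded_linear L" "f differentiable (at x)"
  shows "partial k (\<lambda>y. L (f y)) x = L (partial k f x)"
  using partial_unique[OF bounded_linear.has_derivative[OF assms(1) has_derivative_partial[OF assms(2)]]]
    partial_unique[OF has_derivative_partial[OF assms(2)]]
  by metis

lemma partial_bilinear:
  assumes "bounded_bilinear pr" "f differentiable (at x)" "g differentiable (at x)"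
  shows "partial k (\<lambda>y. pr (f y) (g y)) x = pr (f x) (partial k g x) + pr (partial k f x) (g x)"
  using partial_unique[OF bounded_bilinear.FDERIV[OF assms(1) assms(2,3)[THEN has_derivative_partial]]]
    partial_unique[OF assms(2)[THEN has_derivative_partial]]
    partial_unique[OF assms(3)[THEN has_derivative_partial]]
  by metis

lemma partial_real_chain:
  fixes F :: "real \<Rightarrow> real"
  assumes "(F has_real_derivative F') (at (f x))" "f differentiable (at x)"
  shows "partial k (\<lambda>y. F (f y)) x = F' * partial k f x"
proof -
  have "((\<lambda>y. F (f y)) has_derivative (\<lambda>h. F' * (\<Sum>k\<in>UNIV. h $ k *\<^sub>R partial k f x))) (at x)"
    using has_derivative_compose[OF has_derivative_partial[OF assms(2)]
        assms(1)[unfolded has_field_derivative_def]] by simp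
  from partial_unique[OF this] partial_unique[OF has_derivative_partial[OF assms(2)]]
  show ?thesis by metis
qed

text \<open>The formulas for derivatives of sums, products etc. hold only on \<open>S\<close>, while the recursion for
  \<open>Ck_on\<close> mentions the derivative as a total function. The following congruence bridges
  this gap in each of the closure properties.\<close>
lemma Ck_on_cong:
  assumes "open S" "\<And>y. y \<in> S \<Longrightarrow> f y = g y" "Ck_on m S f"
  shows "Ck_on m S g"
  using assms(2,3)
proof (induction m arbitrary: f g)
  case 0
  then show ?case
    using continuous_on_cong[of S S f g] by simp
next
  case (Suc m)
  have "Ck_on m S (partial k g)" for k
    by (rule Suc.IH[of "partial k f"])
      (use Suc.prems partial_cong_open[OF \<open>open S\<close> _ Suc.prems(1)] in auto)
  moreover have "g differentiable (at x)" if "x \<in> S" for x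
    by (rule differentiable_cong_open[OF \<open>open S\<close> that Suc.prems(1)]) (use Suc.prems that in auto)
  ultimately show ?case by simp
qed

lemma Ck_on_Suc_imp: "Ck_on (Suc m) S f \<Longrightarrow> Ck_on m S f"
proof (induction m arbitrary: f)
  case 0
  then show ?case
    by (auto intro!: continuous_at_imp_continuous_on differentiable_imp_continuous_within)
qed auto

lemma Ck_on_const: "Ck_on m (S :: (real^'a) set) (\<lambda>x. c)"
proof (induction m arbitrary: c)
  case (Suc m)
  have "partial k (\<lambda>x::real^'a. c) = (\<lambda>x. 0)" for k
    by (simp add: fun_eq_iff)
  with Suc show ?case by simp
qed simp

lemma Ck_on_add:
  assumes "open S" "Ck_on m S f" "Ck_on m S g"
  shows "Ck_on m S (\<lambda>x. f x + g x)"
  using assms(2,3)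
proof (induction m arbitrary: f g)
  case 0
  then show ?case by (auto intro: continuous_intros)
next
  case (Suc m)
  have "Ck_on m S (partial k (\<lambda>x. f x + g x))" for k
    by (rule Ck_on_cong[OF \<open>open S\<close>, of "\<lambda>x. partial k f x + partial k g x"])
      (use Suc.prems in \<open>auto simp: partial_add intro: Suc.IH\<close>)
  moreover have "(\<lambda>x. f x + g x) differentiable (at x)" if "x \<in> S" for x
    using Suc.prems that by (intro differentiable_add) auto
  ultimately show ?case by simp
qed

lemma Ck_on_linear:
  assumes "open S" "bounded_linear L" "Ck_on m S f"
  shows "Ck_on m S (\<lambda>x. L (f x))"
  using assms(3)
proof (induction m arbitrary: f)
  case 0
  then show ?case
    using bounded_linear.continuous_on[OF assms(2)] by auto
next
  case (Suc m)
  have "Ck_on m S (partial k (\<lambda>x. L (f x)))" for k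
    by (rule Ck_on_cong[OF \<open>open S\<close>, of "\<lambda>x. L (partial k f x)"])
      (use Suc.prems in \<open>auto simp: partial_linear[OF assms(2)] intro: Suc.IH\<close>)
  moreover have "(\<lambda>x. L (f x)) differentiable (at x)" if "x \<in> S" for x
    using bounded_linear.has_derivative[OF assms(2)] Suc.prems that
    unfolding Ck_on.simps differentiable_def by blast
  ultimately show ?case by simp
qed

lemma Ck_on_bilinear:
  assumes "open S" "bounded_bilinear pr" "Ck_on m S f" "Ck_on m S g"
  shows "Ck_on m S (\<lambda>x. pr (f x) (g x))"
  using assms(3,4)
proof (induction m arbitrary: f g)
  case 0
  then show ?case
    using bounded_bilinear.continuous_on[OF assms(2)] by auto
next
  case (Suc m)
  have "Ck_on m S (partial k (\<lambda>x. pr (f x) (g x)))" for k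
  proof (rule Ck_on_cong[OF \<open>open S\<close>])
    show "Ck_on m S (\<lambda>x. pr (f x) (partial k g x) + pr (partial k f x) (g x))"
      using Suc.prems by (intro Ck_on_add Suc.IH assms(1)) (auto intro: Ck_on_Suc_imp)
    show "pr (f x) (partial k g x) + pr (partial k f x) (g x) = partial k (\<lambda>x. pr (f x) (g x)) x"
      if "x \<in> S" for x
      using Suc.prems that by (simp add: partial_bilinear[OF assms(2)])
  qed
  moreover have "(\<lambda>x. pr (f x) (g x)) differentiable (at x)" if "x \<in> S" for x
    using bounded_bilinear.FDERIV[OF assms(2)] Suc.prems that
    unfolding Ck_on.simps differentiable_def by blast
  ultimately show ?case by simp
qed

lemma Ck_on_inverse:
  fixes f :: "real^'n \<Rightarrow> real"
  assumes "open S" "\<And>x. x \<in> S \<Longrightarrow> f x \<noteq> 0" "Ck_on m S f"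
  shows "Ck_on m S (\<lambda>x. inverse (f x))"
  using assms(3)
proof (induction m)
  case 0
  then show ?case using assms(2) by (auto intro!: continuous_intros)
next
  case (Suc m)
  have IH: "Ck_on m S (\<lambda>x. inverse (f x))"
    using Suc Ck_on_Suc_imp by blast
  have "Ck_on m S (partial k (\<lambda>x. inverse (f x)))" for k
  proof (rule Ck_on_cong[OF \<open>open S\<close>])
    show "Ck_on m S (\<lambda>x. - (inverse (f x) * inverse (f x) * partial k f x))"
      using Suc.prems
      by (intro Ck_on_linear[OF \<open>open S\<close> bounded_linear_minus[OF bounded_linear_ident]]
          Ck_on_bilinear[OF \<open>open S\<close> bounded_bilinear_mult] IH) auto
    show "- (inverse (f x) * inverse (f x) * partial k f x) = partial k (\<lambda>x. inverse (f x)) x"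
      if "x \<in> S" for x
      using Suc.prems that assms(2)
      by (subst partial_real_chain[where F' = "- (inverse (f x) * inverse (f x))"])
        (auto intro!: derivative_eq_intros)
  qed
  moreover have "(\<lambda>x. inverse (f x)) differentiable (at x)" if "x \<in> S" for x
    using Suc.prems that assms(2) by (auto intro!: differentiable_inverse)
  ultimately show ?case by simp
qed

lemma Ck_on_exp:
  fixes f :: "real^'n \<Rightarrow> real"
  assumes "open S" "Ck_on m S f"
  shows "Ck_on m S (\<lambda>x. exp (f x))"
  using assms(2)
proof (induction m)
  case 0
  then show ?case by (auto intro!: continuous_intros)
next
  case (Suc m)
  have IH: "Ck_on m S (\<lambda>x. exp (f x))"
    using Suc Ck_on_Suc_imp by blast
  have "Ck_on m S (partial k (\<lambda>x. exp (f x)))" for k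
  proof (rule Ck_on_cong[OF \<open>open S\<close>])
    show "Ck_on m S (\<lambda>x. exp (f x) * partial k f x)"
      using Suc.prems
      by (intro Ck_on_bilinear[OF \<open>open S\<close> bounded_bilinear_mult] IH) auto
    show "exp (f x) * partial k f x = partial k (\<lambda>x. exp (f x)) x" if "x \<in> S" for x
      using Suc.prems that
      by (subst partial_real_chain[where F' = "exp (f x)"]) (auto intro!: derivative_eq_intros)
  qed
  moreover have "(\<lambda>x. exp (f x)) differentiable (at x)" if "x \<in> S" for x
  proof -
    have "(exp has_derivative (*) (exp (f x))) (at (f x))"
      using DERIV_exp has_field_derivative_def by blast
    then show ?thesis
      using Suc.prems that has_derivative_compose[of f _ x UNIV exp]
      unfolding Ck_on.simps differentiable_def by blast
  qed
  ultimately show ?case by simp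
qed

lemma smooth_on_differentiable: "smooth_on S f \<Longrightarrow> x \<in> S \<Longrightarrow> f differentiable (at x)"
  unfolding smooth_on_def using Ck_on.simps(2) by blast

lemma smooth_on_partial: "smooth_on S f \<Longrightarrow> smooth_on S (partial k f)"
  unfolding smooth_on_def using Ck_on.simps(2) by blast

lemma smooth_on_continuous: "smooth_on S f \<Longrightarrow> continuous_on S f"
  unfolding smooth_on_def using Ck_on.simps(1) by blast

lemma smooth_on_subset:
  assumes "smooth_on S f" "T \<subseteq> S"
  shows "smooth_on T f"
proof -
  have "Ck_on m T g" if "Ck_on m S g" for m and g :: "real^'a \<Rightarrow> 'b"
    using that by (induction m arbitrary: g) (use assms(2) continuous_on_subset in auto)
  then show ?thesis
    using assms(1) unfolding smooth_on_def by blast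
qed

lemma smooth_on_const: "smooth_on S (\<lambda>x. c)"
  by (simp add: smooth_on_def Ck_on_const)

lemma smooth_on_add:
  "open S \<Longrightarrow> smooth_on S f \<Longrightarrow> smooth_on S g \<Longrightarrow> smooth_on S (\<lambda>x. f x + g x)"
  by (simp add: smooth_on_def Ck_on_add)

lemma smooth_on_linear:
  "open S \<Longrightarrow> bounded_linear L \<Longrightarrow> smooth_on S f \<Longrightarrow> smooth_on S (\<lambda>x. L (f x))"
  by (simp add: smooth_on_def Ck_on_linear)

lemma smooth_on_bilinear:
  "open S \<Longrightarrow> bounded_bilinear pr \<Longrightarrow> smooth_on S f \<Longrightarrow> smooth_on S g
    \<Longrightarrow> smooth_on S (\<lambda>x. pr (f x) (g x))"
  by (simp add: smooth_on_def Ck_on_bilinear)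

lemmas smooth_on_scaleR = smooth_on_bilinear[OF _ bounded_bilinear_scaleR]
lemmas smooth_on_mult = smooth_on_bilinear[OF _ bounded_bilinear_mult]
lemmas smooth_on_inner = smooth_on_bilinear[OF _ bounded_bilinear_inner]
lemmas smooth_on_blinfun = smooth_on_bilinear[OF _ bounded_bilinear_blinfun_apply]

lemma smooth_on_inverse:
  fixes f :: "real^'n \<Rightarrow> real"
  shows "open S \<Longrightarrow> (\<And>x. x \<in> S \<Longrightarrow> f x \<noteq> 0) \<Longrightarrow> smooth_on S f
    \<Longrightarrow> smooth_on S (\<lambda>x. inverse (f x))"
  by (simp add: smooth_on_def Ck_on_inverse)

lemma smooth_on_exp:
  fixes f :: "real^'n \<Rightarrow> real"
  shows "open S \<Longrightarrow> smooth_on S f \<Longrightarrow> smooth_on S (\<lambda>x. exp (f x))"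
  by (simp add: smooth_on_def Ck_on_exp)

lemma smooth_on_sum:
  assumes "open S" "\<And>i. i \<in> I \<Longrightarrow> smooth_on S (f i)"
  shows "smooth_on S (\<lambda>x. \<Sum>i\<in>I. f i x)"
  using assms(2)
  by (induction I rule: infinite_finite_induct) (auto intro: smooth_on_const smooth_on_add assms(1))

lemma has_derivative_line:
  fixes f :: "real^'n \<Rightarrow> real"
  assumes "f differentiable (at (x + t *\<^sub>R axis k 1))"
  shows "((\<lambda>t. f (x + t *\<^sub>R axis k 1)) has_real_derivative partial k f (x + t *\<^sub>R axis k 1)) (at t)"
proof -
  have 1: "((\<lambda>t. x + t *\<^sub>R axis k (1::real)) has_derivative (\<lambda>s. s *\<^sub>R axis k 1)) (at t)"
    by (auto intro!: derivative_eq_intros)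
  have "((\<lambda>t. f (x + t *\<^sub>R axis k 1)) has_derivative
      (\<lambda>s. frechet_derivative f (at (x + t *\<^sub>R axis k 1)) (s *\<^sub>R axis k 1))) (at t)"
    using has_derivative_compose[OF 1] assms frechet_derivative_works by blast
  moreover have "linear (frechet_derivative f (at (x + t *\<^sub>R axis k 1)))"
    using assms linear_frechet_derivative by blast
  ultimately show ?thesis
    by (simp add: has_field_derivative_def partial_def linear_cmul mult.commute[of "partial _ _ _"]
        mult_commute_abs)
qed

text \<open>Two applications of the mean value theorem, first along the \<open>j\<close> axis to the difference in the
  direction \<open>k\<close>, then along the \<open>k\<close> axis to the derivative. The second difference on the left is
  symmetric in \<open>j\<close> and \<open>k\<close>, which is what forces mixed derivatives to agree.\<close>
lemma mixed_difference_mean_value: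
  fixes f :: "real^'n \<Rightarrow> real"
  assumes f: "\<And>y. y \<in> ball x r \<Longrightarrow> f differentiable (at y)"
    and fj: "\<And>y. y \<in> ball x r \<Longrightarrow> partial j f differentiable (at y)"
    and t: "0 < t" "2 * t < r"
  shows "\<exists>y\<in>cball x (2 * t). f (x + t *\<^sub>R axis j 1 + t *\<^sub>R axis k 1) - f (x + t *\<^sub>R axis j 1)
      - f (x + t *\<^sub>R axis k 1) + f x = t * t * partial k (partial j f) y"
proof -
  let ?e = "\<lambda>i. axis i (1::real) :: real^'n"
  have near: "dist x (x + s *\<^sub>R ?e j + s' *\<^sub>R ?e k) \<le> 2 * t"
    if "0 \<le> s" "s \<le> t" "0 \<le> s'" "s' \<le> t" for s s'
  proof -
    have "dist x (x + s *\<^sub>R ?e j + s' *\<^sub>R ?e k) = norm (s *\<^sub>R ?e j + s' *\<^sub>R ?e k)"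
      by (metis add.assoc dist_add_cancel dist_norm add.right_neutral norm_minus_commute diff_zero)
    also have "\<dots> \<le> norm (s *\<^sub>R ?e j) + norm (s' *\<^sub>R ?e k)"
      by (rule norm_triangle_ineq)
    also have "\<dots> \<le> 2 * t"
      using that by simp
    finally show ?thesis .
  qed
  have inball: "x + s *\<^sub>R ?e j + s' *\<^sub>R ?e k \<in> ball x r"
    if "0 \<le> s" "s \<le> t" "0 \<le> s'" "s' \<le> t" for s s'
    using near[OF that] t by simp
  define g where "g s = f ((x + t *\<^sub>R ?e k) + s *\<^sub>R ?e j) - f (x + s *\<^sub>R ?e j)" for s
  have "\<exists>s>0. s < t \<and> g t - g 0 = (t - 0) *
      (partial j f ((x + t *\<^sub>R ?e k) + s *\<^sub>R ?e j) - partial j f (x + s *\<^sub>R ?e j))"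
  proof (rule MVT2[OF t(1)])
    fix s assume s: "0 \<le> s" "s \<le> t"
    have "f differentiable (at ((x + t *\<^sub>R ?e k) + s *\<^sub>R ?e j))" "f differentiable (at (x + s *\<^sub>R ?e j))"
      using f[OF inball[of s t]] f[OF inball[of s 0]] s t by (simp_all add: ac_simps)
    then show "(g has_real_derivative (partial j f ((x + t *\<^sub>R ?e k) + s *\<^sub>R ?e j) - partial j f (x + s *\<^sub>R ?e j))) (at s)"
      unfolding g_def by (intro DERIV_diff has_derivative_line)
  qed
  then obtain s where s: "0 < s" "s < t"
    and g: "g t - g 0 = t * (partial j f ((x + s *\<^sub>R ?e j) + t *\<^sub>R ?e k) - partial j f (x + s *\<^sub>R ?e j))"
    by (auto simp: ac_simps)
  have "\<exists>s'>0. s' < t \<and> partial j f ((x + s *\<^sub>R ?e j) + t *\<^sub>R ?e k) - partial j f ((x + s *\<^sub>R ?e j) + 0 *\<^sub>R ?e k)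
      = (t - 0) * partial k (partial j f) ((x + s *\<^sub>R ?e j) + s' *\<^sub>R ?e k)"
    by (rule MVT2[OF t(1)]) (use s in \<open>intro has_derivative_line fj inball; simp\<close>)
  then obtain s' where s': "0 < s'" "s' < t"
    and p: "partial j f ((x + s *\<^sub>R ?e j) + t *\<^sub>R ?e k) - partial j f (x + s *\<^sub>R ?e j)
      = t * partial k (partial j f) ((x + s *\<^sub>R ?e j) + s' *\<^sub>R ?e k)"
    by auto
  show ?thesis
  proof
    show "x + s *\<^sub>R ?e j + s' *\<^sub>R ?e k \<in> cball x (2 * t)"
      using near[of s s'] s s' by simp
    show "f (x + t *\<^sub>R ?e j + t *\<^sub>R ?e k) - f (x + t *\<^sub>R ?e j) - f (x + t *\<^sub>R ?e k) + f x
      = t * t * partial k (partial j f) (x + s *\<^sub>R ?e j + s' *\<^sub>R ?e k)"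
      using g p by (simp add: g_def algebra_simps)
  qed
qed

lemma partial_commute_real:
  fixes f :: "real^'n \<Rightarrow> real"
  assumes "open S" "smooth_on S f" "x \<in> S"
  shows "partial j (partial k f) x = partial k (partial j f) x"
proof -
  obtain r where r: "r > 0" "ball x r \<subseteq> S"
    using assms(1,3) open_contains_ball by blast
  define t where "t n = r / (3 * real (Suc n))" for n
  have t: "0 < t n" "2 * t n < r" for n
    using r by (auto simp: t_def field_simps intro!: add_pos_nonneg)
  have t0: "(\<lambda>n. 2 * t n) \<longlonglongrightarrow> 0"
  proof -
    have "(\<lambda>n. (2 * r / 3) * inverse (real (Suc n))) \<longlonglongrightarrow> (2 * r / 3) * 0"
      by (intro tendsto_mult tendsto_const LIMSEQ_inverse_real_of_nat)
    then show ?thesis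
      by (simp add: t_def field_simps)
  qed
  define \<Delta> where "\<Delta> i i' n = f (x + t n *\<^sub>R axis i 1 + t n *\<^sub>R axis i' 1) - f (x + t n *\<^sub>R axis i 1)
      - f (x + t n *\<^sub>R axis i' 1) + f x" for i i' n
  have lim: "(\<lambda>n. \<Delta> i i' n / (t n * t n)) \<longlonglongrightarrow> partial i' (partial i f) x" for i i'
  proof -
    have "\<exists>y\<in>cball x (2 * t n). \<Delta> i i' n = t n * t n * partial i' (partial i f) y" for n
      unfolding \<Delta>_def
      by (rule mixed_difference_mean_value[of x r])
        (use r t smooth_on_differentiable[OF assms(2)]
          smooth_on_differentiable[OF smooth_on_partial[OF assms(2)]] in auto)
    then have "\<exists>y. \<forall>n. y n \<in> cball x (2 * t n) \<and> \<Delta> i i' n = t n * t n * partial i' (partial i f) (y n)"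
      unfolding Bex_def by (rule choice[OF allI])
    then obtain y where y: "\<And>n. y n \<in> cball x (2 * t n)"
      "\<And>n. \<Delta> i i' n = t n * t n * partial i' (partial i f) (y n)"
      by blast
    have "(\<lambda>n. dist (y n) x) \<longlonglongrightarrow> 0"
      by (rule tendsto_sandwich[OF _ _ tendsto_const t0])
        (use y(1) in \<open>auto simp: dist_commute\<close>)
    then have "y \<longlonglongrightarrow> x"
      using tendsto_dist_iff by blast
    moreover have "isCont (partial i' (partial i f)) x"
      using assms by (meson continuous_on_eq_continuous_at smooth_on_continuous smooth_on_partial)
    ultimately have "(\<lambda>n. partial i' (partial i f) (y n)) \<longlonglongrightarrow> partial i' (partial i f) x"
      using isCont_tendsto_compose by blast
    moreover have "\<Delta> i i' n / (t n * t n) = partial i' (partial i f) (y n)" for n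
      using y(2)[of n] t(1)[of n] by simp
    ultimately show ?thesis by simp
  qed
  have "\<Delta> j k n = \<Delta> k j n" for n
    by (simp add: \<Delta>_def algebra_simps)
  then show ?thesis
    using LIMSEQ_unique[OF lim[of j k]] lim[of k j] by simp
qed

text \<open>Schwarz's theorem for values in an inner product space, by testing against each vector.\<close>
lemma partial_commute:
  fixes f :: "real^'n \<Rightarrow> 'b::real_inner"
  assumes "open S" "smooth_on S f" "x \<in> S"
  shows "partial j (partial k f) x = partial k (partial j f) x"
proof (rule vector_eq_ldot[THEN iffD1], rule allI)
  fix e :: 'b
  have bl: "bounded_linear (\<lambda>v::'b. e \<bullet> v)"
    by (rule bounded_linear_inner_right)
  have *: "partial i (partial i' (\<lambda>y. e \<bullet> f y)) x = e \<bullet> partial i (partial i' f) x" for i i'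
  proof -
    have "partial i (partial i' (\<lambda>y. e \<bullet> f y)) x = partial i (\<lambda>y. e \<bullet> partial i' f y) x"
      by (rule partial_cong_open[OF assms(1,3)])
        (use assms in \<open>simp add: partial_linear[OF bl] smooth_on_differentiable\<close>)
    also have "\<dots> = e \<bullet> partial i (partial i' f) x"
      using partial_linear[OF bl smooth_on_differentiable[OF smooth_on_partial[OF assms(2)] assms(3)]] .
    finally show ?thesis .
  qed
  show "e \<bullet> partial j (partial k f) x = e \<bullet> partial k (partial j f) x"
    using partial_commute_real[OF assms(1) smooth_on_linear[OF assms(1) bl assms(2)] assms(3), of j k]
    by (simp add: *)
qed

section \<open>Integration by parts\<close>

lemma integral_lborel_translation:
  fixes f :: "'a::euclidean_space \<Rightarrow> real"
  assumes "f \<in> borel_measurable borel"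
  shows "(\<integral>x. f (x + c) \<partial>lborel) = (\<integral>x. f x \<partial>lborel)"
proof -
  have "(\<integral>x. f x \<partial>lborel) = (\<integral>x. f x \<partial>distr lborel borel ((+) c))"
    using lborel_distr_plus[of c] by simp
  also have "\<dots> = (\<integral>x. f (c + x) \<partial>lborel)"
    using assms by (subst integral_distr) auto
  finally show ?thesis
    by (simp add: add.commute)
qed

lemma integrable_lborel_compact_support:
  fixes f :: "'a::euclidean_space \<Rightarrow> 'b::euclidean_space"
  assumes "continuous_on UNIV f" "compact K" "\<And>x. x \<notin> K \<Longrightarrow> f x = 0"
  shows "integrable lborel f"
proof -
  have "integrable lborel (\<lambda>x. indicator K x *\<^sub>R f x)"
    by (rule borel_integrable_compact[OF assms(2) continuous_on_subset[OF assms(1)]]) simp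
  moreover have "(\<lambda>x. indicator K x *\<^sub>R f x) = f"
    using assms(3) by (auto simp: fun_eq_iff indicator_def)
  ultimately show ?thesis by simp
qed

text \<open>By translation invariance all difference quotients in the direction \<open>k\<close> have integral zero. They are
  dominated by the maximum of the derivative on a fixed ball, so the integral of their limit
  is zero as well.\<close>
lemma integral_partial_eq_0:
  fixes f :: "real^'n \<Rightarrow> real"
  assumes diff: "\<And>x. f differentiable (at x)"
    and cont: "continuous_on UNIV (partial k f)"
    and K: "compact K" "\<And>x. x \<notin> K \<Longrightarrow> f x = 0"
  shows "(\<integral>x. partial k f x \<partial>lborel) = 0"
proof -
  let ?e = "axis k (1::real) :: real^'n"
  have fcont: "continuous_on UNIV f"
    using diff by (auto intro!: continuous_at_imp_continuous_on differentiable_imp_continuous_within)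
  have fint: "integrable lborel f"
    using integrable_lborel_compact_support[OF fcont K] .
  have off: "partial k f x = 0" if "x \<notin> K" for x
    using partial_cong_open[of "- K" x f "\<lambda>_. 0" k] K that by (simp add: compact_imp_closed open_Compl)
  obtain R where R: "K \<subseteq> cball 0 R" "R > 0"
    using compact_imp_bounded[OF K(1)] unfolding bounded_pos by (auto simp: subset_iff)
  obtain M where M: "\<And>x. \<bar>partial k f x\<bar> \<le> M" "M \<ge> 0"
  proof -
    have "bounded (partial k f ` K)"
      by (intro compact_imp_bounded compact_continuous_image continuous_on_subset[OF cont] K) simp
    then obtain M where M: "\<And>x. x \<in> K \<Longrightarrow> \<bar>partial k f x\<bar> \<le> M" "M > 0"
      unfolding bounded_pos by auto
    have "\<bar>partial k f x\<bar> \<le> M" for x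
      using M off by (cases "x \<in> K") auto
    then show ?thesis
      using that M(2) by (meson less_imp_le)
  qed
  \<comment> \<open>the steps stay below 1, so that the ball enlarged by 1 contains all the supports\<close>
  define t :: "nat \<Rightarrow> real" where "t n = inverse (real (Suc n))" for n
  have t: "0 < t n" "t n \<le> 1" for n
    by (auto simp: t_def field_simps)
  have t0: "t \<longlonglongrightarrow> 0"
    unfolding t_def by (rule LIMSEQ_inverse_real_of_nat)
  define q where "q n x = (f (x + t n *\<^sub>R ?e) - f x) / t n" for n x
  have q0: "(\<integral>x. q n x \<partial>lborel) = 0" for n
  proof -
    have m: "f \<in> borel_measurable borel"
      using fcont borel_measurable_continuous_onI by blast
    have "integrable lborel (\<lambda>x. f (x + t n *\<^sub>R ?e))"
    proof (rule integrable_lborel_compact_support)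
      show "continuous_on UNIV (\<lambda>x. f (x + t n *\<^sub>R ?e))"
        by (intro continuous_on_compose2[OF fcont] continuous_intros) auto
      show "compact ((\<lambda>x. x - t n *\<^sub>R ?e) ` K)"
        by (intro compact_continuous_image K continuous_intros)
      show "f (x + t n *\<^sub>R ?e) = 0" if "x \<notin> (\<lambda>x. x - t n *\<^sub>R ?e) ` K" for x
        using that K(2) by (metis add_diff_cancel_right' image_eqI)
    qed
    then show ?thesis
      unfolding q_def using fint integral_lborel_translation[OF m, of "t n *\<^sub>R ?e"] by simp
  qed
  have qbound: "\<bar>q n x\<bar> \<le> indicator (cball 0 (R + 1)) x * M" for n x
  proof -
    have "\<exists>s>0. s < t n \<and> f (x + t n *\<^sub>R ?e) - f (x + 0 *\<^sub>R ?e) = (t n - 0) * partial k f (x + s *\<^sub>R ?e)"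
      by (rule MVT2[OF t(1)]) (intro has_derivative_line diff)
    then obtain s where s: "0 < s" "s < t n" and "f (x + t n *\<^sub>R ?e) - f x = t n * partial k f (x + s *\<^sub>R ?e)"
      by auto
    then have q: "q n x = partial k f (x + s *\<^sub>R ?e)"
      using t(1)[of n] by (simp add: q_def)
    show ?thesis
    proof (cases "x \<in> cball 0 (R + 1)")
      case True
      then show ?thesis using M q by simp
    next
      case False
      have "norm x \<le> norm (x + s *\<^sub>R ?e) + norm (s *\<^sub>R ?e)"
        by (metis add_diff_cancel_right' norm_triangle_ineq4)
      then have "norm (x + s *\<^sub>R ?e) > R"
        using False s t(2)[of n] by simp
      then have "x + s *\<^sub>R ?e \<notin> K"
        using R(1) by auto
      then show ?thesis using q off M(2) by simp
    qed
  qed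
  have "(\<lambda>n. \<integral>x. q n x \<partial>lborel) \<longlonglongrightarrow> (\<integral>x. partial k f x \<partial>lborel)"
  proof (rule integral_dominated_convergence)
    show "partial k f \<in> borel_measurable lborel"
      using borel_measurable_continuous_onI[OF cont] by simp
    have "f \<in> borel_measurable borel"
      using fcont borel_measurable_continuous_onI by blast
    then show "q n \<in> borel_measurable lborel" for n
      unfolding q_def by measurable
    have "integrable lborel (indicator (cball (0::real^'n) (R + 1)) :: _ \<Rightarrow> real)"
      by (rule integrable_real_indicator)
        (use emeasure_lborel_cball_finite[of "0::real^'n" "R + 1"] in auto)
    then show "integrable lborel (\<lambda>x. indicator (cball (0::real^'n) (R + 1)) x * M)"
      by simp
    show "AE x in lborel. norm (q n x) \<le> indicator (cball 0 (R + 1)) x * M" for n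
      using qbound by simp
    have "(\<lambda>n. q n x) \<longlonglongrightarrow> partial k f x" for x
    proof -
      have "((\<lambda>s. f (x + s *\<^sub>R ?e)) has_real_derivative partial k f (x + 0 *\<^sub>R ?e)) (at 0)"
        by (rule has_derivative_line[OF diff])
      then have "(\<lambda>s. (f (x + s *\<^sub>R ?e) - f x) / s) \<midarrow>0\<rightarrow> partial k f x"
        by (simp add: has_field_derivative_iff)
      moreover have "filterlim t (at 0) sequentially"
        using t0 t(1) by (auto simp: filterlim_at less_imp_neq[symmetric] intro: always_eventually)
      ultimately show ?thesis
        unfolding q_def by (rule filterlim_compose)
    qed
    then show "AE x in lborel. (\<lambda>n. q n x) \<longlonglongrightarrow> partial k f x"
      by simp
  qed
  then show ?thesis
    using q0 by (simp add: LIMSEQ_const_iff)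
qed

definition supported_in :: "'a set \<Rightarrow> ('a \<Rightarrow> 'b::zero) \<Rightarrow> bool" where
  "supported_in K f \<longleftrightarrow> (\<forall>x. x \<notin> K \<longrightarrow> f x = 0)"

lemma supported_in_partial:
  assumes "compact K" "supported_in K f"
  shows "supported_in K (partial k f)"
  unfolding supported_in_def
proof (intro allI impI)
  fix x assume "x \<notin> K"
  then show "partial k f x = 0"
    using partial_cong_open[of "- K" x f "\<lambda>_. 0" k] assms
    by (simp add: supported_in_def compact_imp_closed open_Compl)
qed

lemma continuous_on_UNIV_supported:
  fixes f :: "'a::t2_space \<Rightarrow> 'b::real_normed_vector"
  assumes "open \<Omega>" "compact K" "K \<subseteq> \<Omega>" "continuous_on \<Omega> f" "supported_in K f"
  shows "continuous_on UNIV f"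
proof -
  have "continuous_on (- K) f"
    by (rule continuous_on_eq[of _ "\<lambda>_. 0"]) (use assms(5) in \<open>auto simp: supported_in_def\<close>)
  then have "continuous_on (\<Omega> \<union> - K) f"
    using assms by (intro continuous_on_open_Un) (auto simp: compact_imp_closed open_Compl)
  moreover have "\<Omega> \<union> - K = UNIV"
    using assms(3) by auto
  ultimately show ?thesis by simp
qed

lemma integrable_supported:
  fixes f :: "'a::euclidean_space \<Rightarrow> 'b::euclidean_space"
  assumes "open \<Omega>" "compact K" "K \<subseteq> \<Omega>" "continuous_on \<Omega> f" "supported_in K f"
  shows "integrable (lebesgue_on \<Omega>) f"
proof -
  have "integrable lborel f"
    using integrable_lborel_compact_support[OF continuous_on_UNIV_supported[OF assms]] assms(2,5)
    by (auto simp: supported_in_def)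
  then have "integrable lebesgue f"
    using integrable_completion[OF borel_measurable_integrable] by blast
  then have "integrable lebesgue (\<lambda>x. indicator \<Omega> x *\<^sub>R f x)"
    by (rule integrable_mult_indicator[rotated]) (use assms(1) in auto)
  then show ?thesis
    by (subst integrable_restrict_space) (use assms(1) in auto)
qed

text \<open>The functions that occur below are products of a test function with coefficients that
  make sense only on \<open>\<Omega>\<close>, so smoothness is asked there, and outside a compact subset
  the functions vanish.\<close>
lemma integral_partial_supported_eq_0:
  fixes f :: "real^'n \<Rightarrow> real"
  assumes "open \<Omega>" "compact K" "K \<subseteq> \<Omega>" "smooth_on \<Omega> f" "supported_in K f"
  shows "(\<integral>x. partial k f x \<partial>lebesgue_on \<Omega>) = 0"
proof -
  have sp: "supported_in K (partial k f)"
    by (rule supported_in_partial[OF assms(2,5)])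
  have c: "continuous_on UNIV (partial k f)"
    using continuous_on_UNIV_supported[OF assms(1-3) _ sp] assms(4)
    by (simp add: smooth_on_continuous smooth_on_partial)
  have d: "f differentiable (at x)" for x
  proof (cases "x \<in> \<Omega>")
    case True
    then show ?thesis using assms(4) smooth_on_differentiable by blast
  next
    case False
    then have "x \<in> - K" using assms(3) by auto
    then show ?thesis
      by (rule differentiable_cong_open[of "- K" x "\<lambda>_. 0", rotated])
        (use assms(2,5) in \<open>auto simp: supported_in_def compact_imp_closed open_Compl\<close>)
  qed
  have "(\<integral>x. partial k f x \<partial>lebesgue_on \<Omega>) = (\<integral>x. indicator \<Omega> x *\<^sub>R partial k f x \<partial>lebesgue)"
    using assms(1) by (subst integral_restrict_space) auto
  also have "(\<lambda>x. indicator \<Omega> x *\<^sub>R partial k f x) = partial k f"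
    using sp assms(3) by (auto simp: supported_in_def indicator_def fun_eq_iff)
  also have "(\<integral>x. partial k f x \<partial>lebesgue) = (\<integral>x. partial k f x \<partial>lborel)"
    by (rule integral_completion) (simp add: borel_measurable_continuous_onI[OF c])
  also have "\<dots> = 0"
    by (rule integral_partial_eq_0[OF d c assms(2)]) (use assms(5) in \<open>auto simp: supported_in_def\<close>)
  finally show ?thesis .
qed

section \<open>Clifford multiplication and the Dirac operator\<close>

text \<open>The complex structure of the spinors is forgotten: the imaginary unit enters the operators of
  interest only through an overall factor, and symmetry is all that remains of self-adjointness.\<close>
locale clifford_action =
  fixes \<gamma> :: "'n::finite \<Rightarrow> 'e::euclidean_space \<Rightarrow>\<^sub>L 'e"
  assumes symmetric: "\<gamma> j v \<bullet> w = v \<bullet> \<gamma> j w"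
    and anticommute: "\<gamma> j (\<gamma> k v) + \<gamma> k (\<gamma> j v) = (if j = k then 2 else 0) *\<^sub>R v"
begin

text \<open>Clifford multiplication by a vector; it is an isometry up to the factor \<open>norm a\<close>.\<close>
definition cl :: "real^'n \<Rightarrow> 'e \<Rightarrow>\<^sub>L 'e" where
  "cl a = (\<Sum>k\<in>UNIV. a $ k *\<^sub>R \<gamma> k)"

definition dirac :: "(real^'n \<Rightarrow> 'e) \<Rightarrow> real^'n \<Rightarrow> 'e" where
  "dirac v x = (\<Sum>j\<in>UNIV. \<gamma> j (partial j v x))"

lemma cl_apply: "cl a v = (\<Sum>k\<in>UNIV. a $ k *\<^sub>R \<gamma> k v)"
  by (simp add: cl_def blinfun.sum_left blinfun.scaleR_left)

lemma cl_scaleR: "cl (r *\<^sub>R a) v = r *\<^sub>R cl a v"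
  by (simp add: cl_apply scaleR_sum_right)

lemma cl_symmetric: "cl a v \<bullet> w = v \<bullet> cl a w"
  by (simp add: cl_apply inner_sum_left inner_sum_right symmetric)

lemma anticommute': "\<gamma> j (\<gamma> k v) = (if j = k then 2 else 0) *\<^sub>R v - \<gamma> k (\<gamma> j v)"
  using anticommute[of j k v] by (simp add: algebra_simps)

lemma gamma_cl: "\<gamma> j (cl a v) = (2 * a $ j) *\<^sub>R v - cl a (\<gamma> j v)"
proof -
  have "\<gamma> j (cl a v) + cl a (\<gamma> j v) = (\<Sum>k\<in>UNIV. a $ k *\<^sub>R (\<gamma> j (\<gamma> k v) + \<gamma> k (\<gamma> j v)))"
    by (simp add: cl_apply blinfun.sum_right blinfun.scaleR_right scaleR_add_right sum.distrib)
  also have "\<dots> = (\<Sum>k\<in>UNIV. if k = j then (2 * a $ k) *\<^sub>R v else 0)"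
    by (intro sum.cong) (auto simp: anticommute)
  finally show ?thesis
    by (simp add: algebra_simps)
qed

lemma cl_cl: "cl a (cl a v) = (a \<bullet> a) *\<^sub>R v"
proof -
  have "2 *\<^sub>R cl a (cl a v) = (\<Sum>j\<in>UNIV. a $ j *\<^sub>R \<gamma> j (cl a v)) + cl a (\<Sum>j\<in>UNIV. a $ j *\<^sub>R \<gamma> j v)"
    by (simp add: cl_apply scaleR_2)
  also have "\<dots> = (\<Sum>j\<in>UNIV. a $ j *\<^sub>R (\<gamma> j (cl a v) + cl a (\<gamma> j v)))"
    by (simp add: blinfun.sum_right blinfun.scaleR_right scaleR_add_right sum.distrib)
  also have "\<dots> = 2 *\<^sub>R (a \<bullet> a) *\<^sub>R v"
    by (simp add: gamma_cl inner_vec_def scaleR_sum_left scaleR_sum_right mult.assoc mult.left_commute)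
  finally show ?thesis
    by (metis scaleR_cancel_left zero_neq_numeral)
qed

lemma norm_cl: "norm (cl a v) = norm a * norm v"
proof -
  have "(norm (cl a v))\<^sup>2 = (norm a * norm v)\<^sup>2"
    unfolding power_mult_distrib power2_norm_eq_inner cl_symmetric cl_cl by (simp add: inner_commute)
  then show ?thesis by simp
qed

text \<open>Products of two generators act on the span of the generators by commutators, as infinitesimal
  rotations. This is how the matrix part of the spinorial derivative compensates the rotation
  of frames along the flow.\<close>
lemma commutator_gamma:
  "\<gamma> m (\<gamma> l (\<gamma> k v)) - \<gamma> k (\<gamma> m (\<gamma> l v))
    = (if l = k then 2 else 0) *\<^sub>R \<gamma> m v - (if m = k then 2 else 0) *\<^sub>R \<gamma> l v"
proof -
  have "\<gamma> m (\<gamma> l (\<gamma> k v)) = (if l = k then 2 else 0) *\<^sub>R \<gamma> m v - \<gamma> m (\<gamma> k (\<gamma> l v))"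
    by (subst anticommute') (simp add: blinfun.diff_right blinfun.scaleR_right)
  moreover have "\<gamma> k (\<gamma> m (\<gamma> l v)) = (if m = k then 2 else 0) *\<^sub>R \<gamma> l v - \<gamma> m (\<gamma> k (\<gamma> l v))"
    by (subst anticommute') auto
  ultimately show ?thesis by simp
qed

lemma smooth_on_gamma: "open S \<Longrightarrow> smooth_on S v \<Longrightarrow> smooth_on S (\<lambda>x. \<gamma> k (v x))"
  by (rule smooth_on_linear[OF _ blinfun.bounded_linear_right])

lemma smooth_on_dirac: "open S \<Longrightarrow> smooth_on S v \<Longrightarrow> smooth_on S (dirac v)"
  unfolding dirac_def by (intro smooth_on_sum smooth_on_gamma smooth_on_partial)

lemma supported_in_dirac:
  assumes "compact K" "supported_in K v"
  shows "supported_in K (dirac v)"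
  using supported_in_partial[OF assms]
  by (auto simp: dirac_def supported_in_def blinfun.zero_right intro!: sum.neutral)

lemma dirac_scaleR:
  assumes "f differentiable (at x)" "v differentiable (at x)"
  shows "dirac (\<lambda>y. f y *\<^sub>R v y) x = f x *\<^sub>R dirac v x + cl (grad f x) (v x)"
  by (simp add: dirac_def cl_apply grad_def partial_bilinear[OF bounded_bilinear_scaleR assms]
      blinfun.add_right blinfun.scaleR_right sum.distrib scaleR_sum_right)

text \<open>Clifford multiplication by \<open>Y\<close> anticommutes with the Dirac operator except for the part
  along \<open>Y\<close>, which leaves twice the derivative along \<open>Y\<close>.\<close>
lemma dirac_cl:
  assumes "Y differentiable (at x)" "v differentiable (at x)"
  shows "dirac (\<lambda>y. cl (Y y) (v y)) x
    = (\<Sum>j\<in>UNIV. \<gamma> j (cl (partial j Y x) (v x)))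
      + 2 *\<^sub>R (\<Sum>j\<in>UNIV. Y x $ j *\<^sub>R partial j v x) - cl (Y x) (dirac v x)"
proof -
  have bl: "bounded_bilinear (\<lambda>a v. cl a v)"
  proof -
    have "bounded_linear cl"
      unfolding cl_def by (intro bounded_linear_sum bounded_linear_scaleR_left[THEN bounded_linear_compose]
          bounded_linear_vec_nth)
    then show ?thesis
      using bounded_bilinear.comp1[OF bounded_bilinear_blinfun_apply] by blast
  qed
  have "partial j (\<lambda>y. cl (Y y) (v y)) x = cl (Y x) (partial j v x) + cl (partial j Y x) (v x)" for j
    by (rule partial_bilinear[OF bl assms])
  then have "dirac (\<lambda>y. cl (Y y) (v y)) x
      = (\<Sum>j\<in>UNIV. (2 * Y x $ j) *\<^sub>R partial j v x - cl (Y x) (\<gamma> j (partial j v x)) + \<gamma> j (cl (partial j Y x) (v x)))"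
    by (simp add: dirac_def blinfun.add_right gamma_cl)
  then show ?thesis
    by (simp add: dirac_def sum.distrib sum_subtractf blinfun.sum_right scaleR_sum_right)
qed

lemma integral_dirac_by_parts:
  assumes "open \<Omega>" "compact K" "K \<subseteq> \<Omega>" "supported_in K v" "smooth_on \<Omega> v" "smooth_on \<Omega> w"
  shows "(\<integral>x. dirac v x \<bullet> w x + v x \<bullet> dirac w x \<partial>lebesgue_on \<Omega>) = 0"
proof -
  have sm: "smooth_on \<Omega> (\<lambda>y. \<gamma> j (v y) \<bullet> w y)" for j
    by (intro smooth_on_inner smooth_on_gamma assms)
  have sup: "supported_in K (\<lambda>y. \<gamma> j (v y) \<bullet> w y)" for j
    using assms(4) by (auto simp: supported_in_def blinfun.zero_right)
  have "(\<integral>x. dirac v x \<bullet> w x + v x \<bullet> dirac w x \<partial>lebesgue_on \<Omega>)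
      = (\<integral>x. (\<Sum>j\<in>UNIV. partial j (\<lambda>y. \<gamma> j (v y) \<bullet> w y) x) \<partial>lebesgue_on \<Omega>)"
  proof (rule Bochner_Integration.integral_cong[OF refl])
    fix x assume "x \<in> space (lebesgue_on \<Omega>)"
    then have x: "x \<in> \<Omega>" by simp
    then have v: "v differentiable (at x)" and w: "w differentiable (at x)"
      using assms(5,6) smooth_on_differentiable by blast+
    have gv: "(\<lambda>y. \<gamma> j (v y)) differentiable (at x)" for j
      using smooth_on_differentiable[OF smooth_on_gamma[OF assms(1,5)] x] .
    have "partial j (\<lambda>y. \<gamma> j (v y) \<bullet> w y) x = v x \<bullet> \<gamma> j (partial j w x) + \<gamma> j (partial j v x) \<bullet> w x" for j
      by (simp add: partial_bilinear[OF bounded_bilinear_inner gv w]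
          partial_linear[OF blinfun.bounded_linear_right v] symmetric[of j "v x"])
    then show "dirac v x \<bullet> w x + v x \<bullet> dirac w x = (\<Sum>j\<in>UNIV. partial j (\<lambda>y. \<gamma> j (v y) \<bullet> w y) x)"
      by (simp add: dirac_def inner_sum_left inner_sum_right sum.distrib)
  qed
  also have "\<dots> = (\<Sum>j\<in>UNIV. \<integral>x. partial j (\<lambda>y. \<gamma> j (v y) \<bullet> w y) x \<partial>lebesgue_on \<Omega>)"
    by (intro Bochner_Integration.integral_sum integrable_supported[OF assms(1-3)]
        smooth_on_continuous smooth_on_partial sm supported_in_partial assms(2) sup)
  also have "\<dots> = 0"
    by (simp add: integral_partial_supported_eq_0[OF assms(1-3) sm sup])
  finally show ?thesis .
qed

text \<open>In the double sum, the symmetry of second derivatives pairs \<open>\<gamma> j (\<gamma> k _)\<close> with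
  \<open>\<gamma> k (\<gamma> j _)\<close>, and the Clifford relations leave only the diagonal: the square is the
  Laplacian.\<close>
lemma dirac_dirac:
  assumes "open S" "smooth_on S u" "x \<in> S"
  shows "dirac (dirac u) x = (\<Sum>j\<in>UNIV. partial j (partial j u) x)"
proof -
  have pu: "partial k u differentiable (at x)" for k
    using smooth_on_differentiable[OF smooth_on_partial[OF assms(2)] assms(3)] .
  have gpu: "(\<lambda>y. \<gamma> k (partial k u y)) differentiable (at x)" for k
    using smooth_on_differentiable[OF smooth_on_gamma[OF assms(1) smooth_on_partial[OF assms(2)]] assms(3)] .
  let ?H = "\<lambda>j k. partial j (partial k u) x"
  have D: "dirac (dirac u) x = (\<Sum>j\<in>UNIV. \<Sum>k\<in>UNIV. \<gamma> j (\<gamma> k (?H j k)))"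
    unfolding dirac_def[abs_def]
    by (simp add: partial_sum gpu partial_linear[OF blinfun.bounded_linear_right pu] blinfun.sum_right)
  also have "\<dots> = (\<Sum>k\<in>UNIV. \<Sum>j\<in>UNIV. \<gamma> j (\<gamma> k (?H j k)))"
    by (rule sum.swap)
  also have "\<dots> = (\<Sum>j\<in>UNIV. \<Sum>k\<in>UNIV. \<gamma> k (\<gamma> j (?H j k)))"
    using partial_commute[OF assms] by simp
  finally have "dirac (dirac u) x + dirac (dirac u) x
      = (\<Sum>j\<in>UNIV. \<Sum>k\<in>UNIV. \<gamma> j (\<gamma> k (?H j k)) + \<gamma> k (\<gamma> j (?H j k)))"
    using D by (simp add: sum.distrib)
  also have "\<dots> = (\<Sum>j\<in>UNIV. \<Sum>k\<in>UNIV. if k = j then 2 *\<^sub>R ?H j k else 0)"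
    unfolding anticommute by (intro sum.cong refl) auto
  also have "\<dots> = 2 *\<^sub>R (\<Sum>j\<in>UNIV. ?H j j)"
    by (simp add: scaleR_sum_right)
  finally have "2 *\<^sub>R dirac (dirac u) x = 2 *\<^sub>R (\<Sum>j\<in>UNIV. ?H j j)"
    by (simp add: scaleR_2)
  then show ?thesis
    by (rule real_vector.scale_left_imp_eq[rotated]) simp
qed

text \<open>Both sides equal minus the integral of \<open>u \<bullet> \<Delta>u\<close>, one by partial integration of each
  derivative, the other by \<open>integral_dirac_by_parts\<close> and \<open>dirac_dirac\<close>.\<close>
lemma integral_norm_grad_eq_dirac:
  assumes "open \<Omega>" "compact K" "K \<subseteq> \<Omega>" "supported_in K u" "smooth_on \<Omega> u"
  shows "(\<integral>x. (norm (grad u x))\<^sup>2 \<partial>lebesgue_on \<Omega>) = (\<integral>x. (norm (dirac u x))\<^sup>2 \<partial>lebesgue_on \<Omega>)"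
proof -
  have Du: "smooth_on \<Omega> (dirac u)" and pu: "smooth_on \<Omega> (partial k u)" for k
    using assms smooth_on_dirac smooth_on_partial by blast+
  have flux: "smooth_on \<Omega> (\<lambda>y. u y \<bullet> partial k u y)" for k
    by (intro smooth_on_inner assms pu)
  have sup: "supported_in K (\<lambda>y. u y \<bullet> partial k u y)" for k
    using assms(4) by (simp add: supported_in_def)
  have fluxint: "integrable (lebesgue_on \<Omega>) (\<lambda>x. \<Sum>k\<in>UNIV. partial k (\<lambda>y. u y \<bullet> partial k u y) x)"
    by (intro Bochner_Integration.integrable_sum integrable_supported[OF assms(1-3)]
        smooth_on_continuous smooth_on_partial flux supported_in_partial assms(2) sup)
  have fluxzero: "(\<integral>x. (\<Sum>k\<in>UNIV. partial k (\<lambda>y. u y \<bullet> partial k u y) x) \<partial>lebesgue_on \<Omega>) = 0"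
    by (subst Bochner_Integration.integral_sum)
      (auto intro!: integrable_supported[OF assms(1-3)] smooth_on_continuous smooth_on_partial flux
        supported_in_partial assms(2) sup sum.neutral integral_partial_supported_eq_0[OF assms(1-3)])
  have Dint: "integrable (lebesgue_on \<Omega>) (\<lambda>x. dirac u x \<bullet> dirac u x + u x \<bullet> dirac (dirac u) x)"
    by (rule integrable_supported[OF assms(1-3)])
      (use supported_in_dirac[OF assms(2,4)] assms(4) in
        \<open>auto simp: supported_in_def intro!: smooth_on_continuous smooth_on_add smooth_on_inner
          smooth_on_dirac assms\<close>)
  \<comment> \<open>the two sides differ by integrands that are total derivatives\<close>
  have pointwise: "(norm (grad u x))\<^sup>2 = (\<Sum>k\<in>UNIV. partial k (\<lambda>y. u y \<bullet> partial k u y) x)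
      - (dirac u x \<bullet> dirac u x + u x \<bullet> dirac (dirac u) x) + (norm (dirac u x))\<^sup>2"
    if x: "x \<in> \<Omega>" for x
  proof -
    note d = smooth_on_differentiable[OF _ x]
    have "(norm (grad u x))\<^sup>2 = (\<Sum>k\<in>UNIV. partial k u x \<bullet> partial k u x)"
      by (simp add: grad_def norm_vec_def L2_set_def sum_nonneg power2_norm_eq_inner)
    moreover have "partial k (\<lambda>y. u y \<bullet> partial k u y) x
        = u x \<bullet> partial k (partial k u) x + partial k u x \<bullet> partial k u x" for k
      by (rule partial_bilinear[OF bounded_bilinear_inner d[OF assms(5)] d[OF pu]])
    ultimately show ?thesis
      by (simp add: dirac_dirac[OF assms(1,5) x] inner_sum_right sum.distrib dot_square_norm)
  qed
  have iD: "integrable (lebesgue_on \<Omega>) (\<lambda>x. (norm (dirac u x))\<^sup>2)"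
    by (rule integrable_supported[OF assms(1-3)])
      (use supported_in_dirac[OF assms(2,4)] smooth_on_continuous[OF Du]
        in \<open>auto simp: supported_in_def intro!: continuous_intros\<close>)
  have "(\<integral>x. (norm (grad u x))\<^sup>2 \<partial>lebesgue_on \<Omega>)
      = (\<integral>x. (\<Sum>k\<in>UNIV. partial k (\<lambda>y. u y \<bullet> partial k u y) x)
      - (dirac u x \<bullet> dirac u x + u x \<bullet> dirac (dirac u) x) + (norm (dirac u x))\<^sup>2 \<partial>lebesgue_on \<Omega>)"
    by (rule Bochner_Integration.integral_cong[OF refl]) (use pointwise in simp)
  also have "\<dots> = (\<integral>x. (norm (dirac u x))\<^sup>2 \<partial>lebesgue_on \<Omega>)"
    using fluxint fluxzero Dint iD integral_dirac_by_parts[OF assms Du] by simp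
  finally show ?thesis .
qed

end

section \<open>The spinorial derivative along a conformal Killing field\<close>

text \<open>The assumption \<open>conformal\<close> says that the symmetric part of the derivative of \<open>Y\<close> is a multiple
  of the identity, so the flow of \<open>Y\<close> preserves the Euclidean metric up to a conformal factor.\<close>
locale conformal_killing_field = clifford_action \<gamma>
  for \<gamma> :: "'n::finite \<Rightarrow> 'e::euclidean_space \<Rightarrow>\<^sub>L 'e" +
  fixes \<Omega> :: "(real^'n) set" and Y :: "real^'n \<Rightarrow> real^'n" and \<sigma> :: "real^'n \<Rightarrow> real"
  assumes open_domain: "open \<Omega>"
    and smooth_field: "smooth_on \<Omega> Y"
    and conformal: "x \<in> \<Omega> \<Longrightarrow>
      partial m Y x $ k + partial k Y x $ m = (if m = k then 2 * \<sigma> x else 0)"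
begin

definition divergence :: "real^'n \<Rightarrow> real" where
  "divergence x = (\<Sum>k\<in>UNIV. partial k Y x $ k)"

text \<open>The Dirac operator applied to the operator-valued function \<open>\<lambda>x. cl (Y x)\<close>.\<close>
definition cliff_grad :: "real^'n \<Rightarrow> 'e \<Rightarrow>\<^sub>L 'e" where
  "cliff_grad x = (\<Sum>m\<in>UNIV. \<Sum>k\<in>UNIV. partial m Y x $ k *\<^sub>R (\<gamma> m o\<^sub>L \<gamma> k))"

text \<open>For a conformal Killing field with antisymmetric part
  \<open>\<omega> m k = partial m Y x $ k - \<sigma> x * (if m = k then 1 else 0)\<close> this is
  \<open>1/2 * divergence x + 1/4 * (\<Sum>m k. \<omega> m k * \<gamma> m * \<gamma> k)\<close>: half the divergence makes the
  derivative along the flow skew-adjoint, and the sum is the lift of the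
  infinitesimal rotation \<open>\<omega>\<close> to spinors.\<close>
definition spin :: "real^'n \<Rightarrow> 'e \<Rightarrow>\<^sub>L 'e" where
  "spin x = (1/4) *\<^sub>R (divergence x *\<^sub>R id_blinfun + cliff_grad x)"

definition flow_deriv :: "(real^'n \<Rightarrow> 'b::real_normed_vector) \<Rightarrow> real^'n \<Rightarrow> 'b" where
  "flow_deriv v x = (\<Sum>k\<in>UNIV. Y x $ k *\<^sub>R partial k v x)"

text \<open>The spinorial Lie derivative along \<open>Y\<close> (Kosmann), in the normalization that is skew-adjoint
  for Lebesgue measure.\<close>
definition spin_deriv :: "(real^'n \<Rightarrow> 'e) \<Rightarrow> real^'n \<Rightarrow> 'e" where
  "spin_deriv v x = flow_deriv v x + spin x (v x)"

lemma cliff_grad_apply: "cliff_grad x v = (\<Sum>m\<in>UNIV. \<gamma> m (cl (partial m Y x) v))"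
  by (simp add: cliff_grad_def cl_apply blinfun.bilinear_simps blinfun.sum_left blinfun.sum_right)

lemma spin_apply: "spin x v = (1/4) *\<^sub>R (divergence x *\<^sub>R v + cliff_grad x v)"
  by (simp add: spin_def blinfun.bilinear_simps)

lemma smooth_on_component: "smooth_on \<Omega> (\<lambda>x. Y x $ k)"
  by (rule smooth_on_linear[OF open_domain bounded_linear_vec_nth smooth_field])

lemma smooth_on_partial_component: "smooth_on \<Omega> (\<lambda>x. partial m Y x $ k)"
  by (rule smooth_on_linear[OF open_domain bounded_linear_vec_nth smooth_on_partial[OF smooth_field]])

lemma smooth_on_spin: "smooth_on \<Omega> spin"
  unfolding spin_def[abs_def] divergence_def cliff_grad_def
  by (intro smooth_on_scaleR smooth_on_add smooth_on_sum smooth_on_const open_domain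
      smooth_on_partial_component)

lemma smooth_on_flow_deriv: "smooth_on \<Omega> v \<Longrightarrow> smooth_on \<Omega> (flow_deriv v)"
  unfolding flow_deriv_def[abs_def]
  by (intro smooth_on_scaleR smooth_on_sum open_domain smooth_on_component smooth_on_partial)

lemma smooth_on_spin_deriv: "smooth_on \<Omega> v \<Longrightarrow> smooth_on \<Omega> (spin_deriv v)"
  unfolding spin_deriv_def[abs_def]
  by (intro smooth_on_add smooth_on_blinfun open_domain smooth_on_spin smooth_on_flow_deriv)

lemma smooth_on_cl_field: "smooth_on \<Omega> v \<Longrightarrow> smooth_on \<Omega> (\<lambda>x. cl (Y x) (v x))"
  unfolding cl_apply
  by (intro smooth_on_scaleR smooth_on_sum open_domain smooth_on_component smooth_on_gamma)

lemma supported_in_flow_deriv: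
  "compact K \<Longrightarrow> supported_in K v \<Longrightarrow> supported_in K (flow_deriv v)"
  using supported_in_partial[of K v] by (auto simp: flow_deriv_def supported_in_def)

lemma supported_in_spin_deriv:
  "compact K \<Longrightarrow> supported_in K v \<Longrightarrow> supported_in K (spin_deriv v)"
  using supported_in_flow_deriv[of K v]
  by (auto simp: spin_deriv_def supported_in_def blinfun.zero_right)

lemma spin_adjoint: "spin x v \<bullet> w + v \<bullet> spin x w = divergence x * (v \<bullet> w)"
proof -
  have "cliff_grad x v \<bullet> w + v \<bullet> cliff_grad x w
      = (\<Sum>m\<in>UNIV. v \<bullet> (cl (partial m Y x) (\<gamma> m w) + \<gamma> m (cl (partial m Y x) w)))"
    by (simp add: cliff_grad_apply inner_sum_left inner_sum_right symmetric cl_symmetric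
        inner_add_right sum.distrib)
  also have "\<dots> = 2 * divergence x * (v \<bullet> w)"
    by (simp add: gamma_cl divergence_def sum_distrib_left sum_distrib_right)
  finally show ?thesis
    by (simp add: spin_apply inner_add_left inner_add_right algebra_simps)
qed

text \<open>The commutator of \<open>spin\<close> with a generator rotates it by the antisymmetric part of the derivative of
  \<open>Y\<close>. Only here and in \<open>spin_deriv_cl_field\<close> does the conformal Killing equation enter.\<close>
lemma spin_gamma:
  assumes "x \<in> \<Omega>"
  shows "spin x (\<gamma> k v) - \<gamma> k (spin x v)
    = (\<Sum>m\<in>UNIV. partial m Y x $ k *\<^sub>R \<gamma> m v) - \<sigma> x *\<^sub>R \<gamma> k v"
proof -
  let ?D = "\<lambda>m k. partial m Y x $ k"
  have vec_arith: "2 *\<^sub>R a - 2 *\<^sub>R ((2 * s) *\<^sub>R b - a) = 4 *\<^sub>R (a - s *\<^sub>R b)" for a b :: 'e and s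
    by (subst vector_eq_ldot[symmetric]) (simp add: inner_diff_right algebra_simps)
  have "4 *\<^sub>R (spin x (\<gamma> k v) - \<gamma> k (spin x v)) = cliff_grad x (\<gamma> k v) - \<gamma> k (cliff_grad x v)"
    by (simp add: spin_apply blinfun.bilinear_simps algebra_simps)
  also have "\<dots> = (\<Sum>m\<in>UNIV. \<Sum>l\<in>UNIV. ?D m l *\<^sub>R (\<gamma> m (\<gamma> l (\<gamma> k v)) - \<gamma> k (\<gamma> m (\<gamma> l v))))"
    by (simp add: cliff_grad_def blinfun.bilinear_simps blinfun.sum_left blinfun.sum_right
        scaleR_diff_right sum_subtractf)
  also have "\<dots> = (\<Sum>m\<in>UNIV. \<Sum>l\<in>UNIV. (if l = k then (2 * ?D m l) *\<^sub>R \<gamma> m v else 0))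
      - (\<Sum>m\<in>UNIV. \<Sum>l\<in>UNIV. (if m = k then (2 * ?D m l) *\<^sub>R \<gamma> l v else 0))"
    unfolding commutator_gamma sum_subtractf[symmetric]
    by (intro sum.cong refl) (auto simp: scaleR_diff_right)
  also have "\<dots> = 2 *\<^sub>R (\<Sum>m\<in>UNIV. ?D m k *\<^sub>R \<gamma> m v) - 2 *\<^sub>R (\<Sum>l\<in>UNIV. ?D k l *\<^sub>R \<gamma> l v)"
  proof -
    have "(\<Sum>m\<in>UNIV. \<Sum>l\<in>UNIV. (if m = k then (2 * ?D m l) *\<^sub>R \<gamma> l v else 0))
      = (\<Sum>l\<in>UNIV. \<Sum>m\<in>UNIV. (if m = k then (2 * ?D m l) *\<^sub>R \<gamma> l v else 0))"
      by (rule sum.swap)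
    then show ?thesis
      by (simp add: scaleR_sum_right)
  qed
  also have "(\<Sum>l\<in>UNIV. ?D k l *\<^sub>R \<gamma> l v)
      = (\<Sum>l\<in>UNIV. (if l = k then (2 * \<sigma> x) *\<^sub>R \<gamma> l v else 0) - ?D l k *\<^sub>R \<gamma> l v)"
  proof (rule sum.cong[OF refl])
    fix l
    \<comment> \<open>the conformal Killing equation trades the derivative for its transpose\<close>
    have "?D k l = (if l = k then 2 * \<sigma> x else 0) - ?D l k"
      using conformal[OF assms, of k l] by auto
    then show "?D k l *\<^sub>R \<gamma> l v = (if l = k then (2 * \<sigma> x) *\<^sub>R \<gamma> l v else 0) - ?D l k *\<^sub>R \<gamma> l v"
      by (simp only: scaleR_diff_left) auto
  qed
  also have "\<dots> = (2 * \<sigma> x) *\<^sub>R \<gamma> k v - (\<Sum>l\<in>UNIV. ?D l k *\<^sub>R \<gamma> l v)"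
    by (simp add: sum_subtractf)
  finally have "4 *\<^sub>R (spin x (\<gamma> k v) - \<gamma> k (spin x v))
      = 4 *\<^sub>R ((\<Sum>m\<in>UNIV. partial m Y x $ k *\<^sub>R \<gamma> m v) - \<sigma> x *\<^sub>R \<gamma> k v)"
    unfolding vec_arith .
  then show ?thesis
    by (rule real_vector.scale_left_imp_eq[rotated]) simp
qed

text \<open>The field \<open>Y\<close> is invariant under its own flow. The bracket with \<open>cl Y\<close> therefore retains only
  a conformal weight: differentiating the components gives the terms \<open>?A\<close>, rotating the
  generators gives \<open>?B\<close> minus one \<open>\<sigma>\<close>, and \<open>?A + ?B\<close> is evaluated by the conformal Killing equation.\<close>
lemma spin_deriv_cl_field:
  assumes "x \<in> \<Omega>" "smooth_on \<Omega> w"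
  shows "spin_deriv (\<lambda>y. cl (Y y) (w y)) x = cl (Y x) (spin_deriv w x) + \<sigma> x *\<^sub>R cl (Y x) (w x)"
proof -
  let ?D = "\<lambda>m k. partial m Y x $ k"
  have w: "w differentiable (at x)" and gw: "(\<lambda>y. \<gamma> k (w y)) differentiable (at x)" for k
    using smooth_on_differentiable[OF _ assms(1)] assms(2) smooth_on_gamma[OF open_domain] by blast+
  have Yc: "(\<lambda>y. Y y $ k) differentiable (at x)" for k
    using smooth_on_differentiable[OF smooth_on_component assms(1)] .
  have Yd: "Y differentiable (at x)"
    using smooth_on_differentiable[OF smooth_field assms(1)] .
  have pc: "partial m (\<lambda>y. Y y $ k) x = ?D m k" for m k
    by (rule partial_linear[OF bounded_linear_vec_nth Yd])
  have p: "partial m (\<lambda>y. cl (Y y) (w y)) x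
      = cl (Y x) (partial m w x) + (\<Sum>k\<in>UNIV. ?D m k *\<^sub>R \<gamma> k (w x))" for m
  proof -
    have "(\<lambda>y. Y y $ k *\<^sub>R \<gamma> k (w y)) differentiable (at x)" for k
      using smooth_on_differentiable[OF smooth_on_scaleR[OF open_domain smooth_on_component
            smooth_on_gamma[OF open_domain assms(2)]] assms(1)] .
    then show ?thesis
      unfolding cl_apply
      by (simp add: partial_sum partial_bilinear[OF bounded_bilinear_scaleR Yc gw] pc
          partial_linear[OF blinfun.bounded_linear_right w] sum.distrib)
  qed
  let ?A = "\<Sum>k\<in>UNIV. \<Sum>m\<in>UNIV. (Y x $ m * ?D m k) *\<^sub>R \<gamma> k (w x)"
  let ?B = "\<Sum>k\<in>UNIV. \<Sum>m\<in>UNIV. (Y x $ m * ?D k m) *\<^sub>R \<gamma> k (w x)"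
  have A: "(\<Sum>m\<in>UNIV. Y x $ m *\<^sub>R (\<Sum>k\<in>UNIV. ?D m k *\<^sub>R \<gamma> k (w x)))
      = (\<Sum>k\<in>UNIV. \<Sum>m\<in>UNIV. (Y x $ m * ?D m k) *\<^sub>R \<gamma> k (w x))"
    by (subst sum.swap) (simp add: scaleR_sum_right)
  have "spin x (cl (Y x) (w x)) - cl (Y x) (spin x (w x))
      = (\<Sum>m\<in>UNIV. Y x $ m *\<^sub>R (spin x (\<gamma> m (w x)) - \<gamma> m (spin x (w x))))"
    by (simp add: cl_apply blinfun.bilinear_simps blinfun.sum_right scaleR_diff_right sum_subtractf)
  then have "spin x (cl (Y x) (w x)) - cl (Y x) (spin x (w x))
      = (\<Sum>m\<in>UNIV. \<Sum>k\<in>UNIV. (Y x $ m * ?D k m) *\<^sub>R \<gamma> k (w x)) - \<sigma> x *\<^sub>R cl (Y x) (w x)"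
    by (simp add: spin_gamma[OF assms(1)] scaleR_diff_right sum_subtractf scaleR_sum_right cl_apply
        mult.commute)
  then have "spin x (cl (Y x) (w x)) - cl (Y x) (spin x (w x)) = ?B - \<sigma> x *\<^sub>R cl (Y x) (w x)"
    by (subst sum.swap)
  then have spin: "spin x (cl (Y x) (w x)) = ?B - \<sigma> x *\<^sub>R cl (Y x) (w x) + cl (Y x) (spin x (w x))"
    by (simp only: diff_eq_eq)
  have "?A + ?B = (2 * \<sigma> x) *\<^sub>R cl (Y x) (w x)"
  proof -
    have "(Y x $ m * ?D m k) *\<^sub>R \<gamma> k (w x) + (Y x $ m * ?D k m) *\<^sub>R \<gamma> k (w x)
        = (if m = k then (2 * \<sigma> x * Y x $ k) *\<^sub>R \<gamma> k (w x) else 0)" for m k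
      using conformal[OF assms(1), of m k]
      by (simp flip: scaleR_add_left distrib_left)
    then show ?thesis
      by (simp flip: sum.distrib) (simp add: cl_apply scaleR_sum_right)
  qed
  then have AB: "?A = \<sigma> x *\<^sub>R cl (Y x) (w x) + \<sigma> x *\<^sub>R cl (Y x) (w x) - ?B"
    by (simp only: eq_diff_eq mult_2 scaleR_add_left)
  have "flow_deriv (\<lambda>y. cl (Y y) (w y)) x = cl (Y x) (flow_deriv w x) + ?A"
    unfolding A[symmetric]
    by (simp add: flow_deriv_def p scaleR_add_right sum.distrib blinfun.sum_right blinfun.scaleR_right)
  then show ?thesis
    unfolding AB by (simp add: spin_deriv_def blinfun.add_right spin)
qed

text \<open>The Dirac operator applied to the coefficient \<open>spin\<close>: the zero order error in the commutators
  below.\<close>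
definition spin_grad :: "real^'n \<Rightarrow> 'e \<Rightarrow>\<^sub>L 'e" where
  "spin_grad x = (\<Sum>j\<in>UNIV. \<gamma> j o\<^sub>L partial j spin x)"

text \<open>Conformal covariance of the Dirac operator. The first order part of the commutator has
  coefficients \<open>spin \<gamma>\<^sub>k - \<gamma>\<^sub>k spin - \<Sum>m. partial m Y $ k *\<^sub>R \<gamma>\<^sub>m\<close>, and by \<open>spin_gamma\<close> this is
  \<open>- \<sigma> \<gamma>\<^sub>k\<close>.\<close>
lemma spin_deriv_dirac:
  assumes "x \<in> \<Omega>" "smooth_on \<Omega> v"
  shows "spin_deriv (dirac v) x
    = dirac (spin_deriv v) x - \<sigma> x *\<^sub>R dirac v x - spin_grad x (v x)"
proof -
  let ?D = "\<lambda>m k. partial m Y x $ k"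
  note d = smooth_on_differentiable[OF _ assms(1)]
  note v = d[OF assms(2)]
  have pv: "partial k v differentiable (at x)" for k
    by (intro d smooth_on_partial assms)
  have gpv: "(\<lambda>y. \<gamma> j (partial j v y)) differentiable (at x)" for j
    by (intro d smooth_on_gamma open_domain smooth_on_partial assms)
  have Yc: "(\<lambda>y. Y y $ k) differentiable (at x)" for k
    by (rule d[OF smooth_on_component])
  have pc: "partial m (\<lambda>y. Y y $ k) x = ?D m k" for m k
    by (rule partial_linear[OF bounded_linear_vec_nth d[OF smooth_field]])
  have "partial k (dirac v) x = (\<Sum>j\<in>UNIV. \<gamma> j (partial k (partial j v) x))" for k
    unfolding dirac_def[abs_def]
    by (simp add: partial_sum gpv partial_linear[OF blinfun.bounded_linear_right pv])
  then have 1: "spin_deriv (dirac v) x = (\<Sum>k\<in>UNIV. \<Sum>j\<in>UNIV. Y x $ k *\<^sub>R \<gamma> j (partial k (partial j v) x))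
      + (\<Sum>k\<in>UNIV. spin x (\<gamma> k (partial k v x)))"
    by (simp add: spin_deriv_def flow_deriv_def scaleR_sum_right dirac_def blinfun.sum_right)
  have "partial j (flow_deriv v) x
      = (\<Sum>k\<in>UNIV. Y x $ k *\<^sub>R partial k (partial j v) x + ?D j k *\<^sub>R partial k v x)" for j
  proof -
    have "(\<lambda>y. Y y $ k *\<^sub>R partial k v y) differentiable (at x)" for k
      by (intro d smooth_on_scaleR open_domain smooth_on_component smooth_on_partial assms)
    then show ?thesis
      unfolding flow_deriv_def[abs_def]
      by (simp add: partial_sum partial_bilinear[OF bounded_bilinear_scaleR Yc pv] pc
          partial_commute[OF open_domain assms(2,1), of j])
  qed
  moreover have "partial j (\<lambda>y. spin y (v y)) x = spin x (partial j v x) + partial j spin x (v x)" for j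
    by (rule partial_bilinear[OF bounded_bilinear_blinfun_apply d[OF smooth_on_spin] v])
  moreover have "partial j (spin_deriv v) x = partial j (flow_deriv v) x + partial j (\<lambda>y. spin y (v y)) x" for j
    unfolding spin_deriv_def[abs_def]
    by (intro partial_add d smooth_on_flow_deriv smooth_on_blinfun open_domain smooth_on_spin assms)
  ultimately have "dirac (spin_deriv v) x
      = (\<Sum>j\<in>UNIV. \<Sum>k\<in>UNIV. Y x $ k *\<^sub>R \<gamma> j (partial k (partial j v) x))
        + (\<Sum>j\<in>UNIV. \<Sum>k\<in>UNIV. ?D j k *\<^sub>R \<gamma> j (partial k v x))
        + (\<Sum>j\<in>UNIV. \<gamma> j (spin x (partial j v x))) + spin_grad x (v x)"
    by (simp add: dirac_def spin_grad_def blinfun.bilinear_simps blinfun.sum_right blinfun.sum_left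
        sum.distrib)
  moreover have "(\<Sum>j\<in>UNIV. \<Sum>k\<in>UNIV. Y x $ k *\<^sub>R \<gamma> j (partial k (partial j v) x))
      = (\<Sum>k\<in>UNIV. \<Sum>j\<in>UNIV. Y x $ k *\<^sub>R \<gamma> j (partial k (partial j v) x))"
    by (rule sum.swap)
  moreover have "(\<Sum>j\<in>UNIV. \<Sum>k\<in>UNIV. ?D j k *\<^sub>R \<gamma> j (partial k v x))
      = (\<Sum>k\<in>UNIV. \<Sum>j\<in>UNIV. ?D j k *\<^sub>R \<gamma> j (partial k v x))"
    by (rule sum.swap)
  moreover have "(\<Sum>k\<in>UNIV. spin x (\<gamma> k (partial k v x))) - (\<Sum>k\<in>UNIV. \<gamma> k (spin x (partial k v x)))
      = (\<Sum>k\<in>UNIV. \<Sum>j\<in>UNIV. ?D j k *\<^sub>R \<gamma> j (partial k v x)) - \<sigma> x *\<^sub>R dirac v x"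
    by (simp add: spin_gamma[OF assms(1)] sum_subtractf dirac_def scaleR_sum_right flip: sum_subtractf)
  ultimately show ?thesis
    by (simp add: 1 algebra_simps)
qed

text \<open>The weight \<open>\<sigma>\<close> of \<open>cl Y\<close> cancels the weight \<open>- \<sigma>\<close> of the Dirac operator, so no derivative
  of \<open>v\<close> is left in the commutator. This is the place where the limiting Carleman condition pays off: a first
  order error could not be absorbed.\<close>
lemma spin_deriv_cl_dirac:
  assumes "x \<in> \<Omega>" "smooth_on \<Omega> v"
  shows "spin_deriv (\<lambda>y. cl (Y y) (dirac v y)) x
    = cl (Y x) (dirac (spin_deriv v) x) - cl (Y x) (spin_grad x (v x))"
  using spin_deriv_cl_field[OF assms(1) smooth_on_dirac[OF open_domain assms(2)]]
  by (simp add: spin_deriv_dirac[OF assms] blinfun.bilinear_simps)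

lemma integral_spin_deriv_by_parts:
  assumes "compact K" "K \<subseteq> \<Omega>" "supported_in K v" "smooth_on \<Omega> v" "smooth_on \<Omega> w"
  shows "(\<integral>x. spin_deriv v x \<bullet> w x + v x \<bullet> spin_deriv w x \<partial>lebesgue_on \<Omega>) = 0"
proof -
  let ?f = "\<lambda>k y. Y y $ k * (v y \<bullet> w y)"
  have sm: "smooth_on \<Omega> (?f k)" for k
    by (intro smooth_on_mult smooth_on_inner open_domain smooth_on_component assms)
  have sup: "supported_in K (?f k)" for k
    using assms(3) by (auto simp: supported_in_def)
  have "(\<integral>x. spin_deriv v x \<bullet> w x + v x \<bullet> spin_deriv w x \<partial>lebesgue_on \<Omega>)
      = (\<integral>x. (\<Sum>k\<in>UNIV. partial k (?f k) x) \<partial>lebesgue_on \<Omega>)"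
  proof (rule Bochner_Integration.integral_cong[OF refl])
    fix x assume "x \<in> space (lebesgue_on \<Omega>)"
    then have x: "x \<in> \<Omega>" by simp
    note d = smooth_on_differentiable[OF _ x]
    have vw: "(\<lambda>y. v y \<bullet> w y) differentiable (at x)"
      by (intro d smooth_on_inner open_domain assms)
    have "partial k (?f k) x
        = Y x $ k * (v x \<bullet> partial k w x + partial k v x \<bullet> w x) + partial k Y x $ k * (v x \<bullet> w x)" for k
      by (simp add: partial_bilinear[OF bounded_bilinear_mult d[OF smooth_on_component] vw]
          partial_bilinear[OF bounded_bilinear_inner d[OF assms(4)] d[OF assms(5)]]
          partial_linear[OF bounded_linear_vec_nth d[OF smooth_field]])
    then show "spin_deriv v x \<bullet> w x + v x \<bullet> spin_deriv w x = (\<Sum>k\<in>UNIV. partial k (?f k) x)"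
      using spin_adjoint[of x "v x" "w x"]
      by (simp add: spin_deriv_def flow_deriv_def inner_add_left inner_add_right inner_sum_left
          inner_sum_right sum.distrib distrib_left divergence_def sum_distrib_right)
  qed
  also have "\<dots> = (\<Sum>k\<in>UNIV. \<integral>x. partial k (?f k) x \<partial>lebesgue_on \<Omega>)"
    by (intro Bochner_Integration.integral_sum integrable_supported[OF open_domain assms(1,2)]
        smooth_on_continuous smooth_on_partial sm supported_in_partial assms(1) sup)
  also have "\<dots> = 0"
    by (simp add: integral_partial_supported_eq_0[OF open_domain assms(1,2) sm sup])
  finally show ?thesis .
qed

end

section \<open>The Carleman estimate for a conformal Killing field\<close>

context conformal_killing_field
begin

text \<open>The multiplier identity, with everything on one side. It combines four partial
  integrations: the skew-adjointness of \<open>spin_deriv\<close> against \<open>cl Y (dirac v)\<close>, against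
  \<open>spin_deriv v\<close> and against \<open>a v\<close>, and that of \<open>dirac\<close> against \<open>cl Y (spin_deriv v)\<close>. The
  second derivatives of \<open>v\<close> cancel because \<open>spin_deriv\<close> and \<open>cl Y \<circ> dirac\<close> commute to leading
  order.\<close>
lemma integral_multiplier_eq_0:
  assumes K: "compact K" "K \<subseteq> \<Omega>" "supported_in K v"
    and v: "smooth_on \<Omega> v" and a: "smooth_on \<Omega> a"
  shows "integrable (lebesgue_on \<Omega>) (\<lambda>x. 2 * (spin_deriv v x \<bullet> (cl (Y x) (dirac v x) - a x *\<^sub>R v x))
      - 2 * (spin_deriv v x \<bullet> spin_deriv v x)
      - v x \<bullet> cl (Y x) (spin_grad x (v x))
      - v x \<bullet> (2 *\<^sub>R spin x - cliff_grad x) (spin_deriv v x)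
      - flow_deriv a x * (v x \<bullet> v x))" (is "integrable _ ?J")
    and "(\<integral>x. 2 * (spin_deriv v x \<bullet> (cl (Y x) (dirac v x) - a x *\<^sub>R v x))
      - 2 * (spin_deriv v x \<bullet> spin_deriv v x)
      - v x \<bullet> cl (Y x) (spin_grad x (v x))
      - v x \<bullet> (2 *\<^sub>R spin x - cliff_grad x) (spin_deriv v x)
      - flow_deriv a x * (v x \<bullet> v x) \<partial>lebesgue_on \<Omega>) = 0" (is "?I = 0")
proof -
  let ?S = "spin_deriv v" and ?R = "\<lambda>x. cl (Y x) (dirac v x)"
  let ?T = "\<lambda>x. cl (Y x) (?S x)" and ?av = "\<lambda>x. a x *\<^sub>R v x"
  note sm = v a smooth_on_dirac[OF open_domain v] smooth_on_spin_deriv[OF v]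
  have S: "smooth_on \<Omega> ?S" and R: "smooth_on \<Omega> ?R" and T: "smooth_on \<Omega> ?T" and av: "smooth_on \<Omega> ?av"
    using sm by (auto intro: smooth_on_cl_field smooth_on_scaleR open_domain)
  define Ia where "Ia x = ?S x \<bullet> ?R x + v x \<bullet> spin_deriv ?R x" for x
  define Ib where "Ib x = dirac v x \<bullet> ?T x + v x \<bullet> dirac ?T x" for x
  define Ic where "Ic x = ?S x \<bullet> ?S x + v x \<bullet> spin_deriv ?S x" for x
  define Id where "Id x = ?S x \<bullet> ?av x + v x \<bullet> spin_deriv ?av x" for x
  have sup: "supported_in K f" if "\<And>x. v x = 0 \<Longrightarrow> ?S x = 0 \<Longrightarrow> dirac v x = 0 \<Longrightarrow> f x = 0"
    for f :: "real^'n \<Rightarrow> real"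
    using that K(3) supported_in_dirac[OF K(1,3)] supported_in_spin_deriv[OF K(1,3)]
    by (simp add: supported_in_def)
  have int: "integrable (lebesgue_on \<Omega>) Ia" "integrable (lebesgue_on \<Omega>) Ib"
    "integrable (lebesgue_on \<Omega>) Ic" "integrable (lebesgue_on \<Omega>) Id"
    unfolding Ia_def[abs_def] Ib_def[abs_def] Ic_def[abs_def] Id_def[abs_def]
    by (rule integrable_supported[OF open_domain K(1,2)];
        intro smooth_on_continuous smooth_on_add smooth_on_inner smooth_on_spin_deriv smooth_on_dirac
          open_domain S R T av sm sup; simp)+
  have zero: "integral\<^sup>L (lebesgue_on \<Omega>) Ia = 0" "integral\<^sup>L (lebesgue_on \<Omega>) Ib = 0"
    "integral\<^sup>L (lebesgue_on \<Omega>) Ic = 0" "integral\<^sup>L (lebesgue_on \<Omega>) Id = 0"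
    unfolding Ia_def[abs_def] Ib_def[abs_def] Ic_def[abs_def] Id_def[abs_def]
    by (rule integral_spin_deriv_by_parts[OF K v] integral_dirac_by_parts[OF open_domain K v];
        rule R S T av)+
  have pointwise: "?J x = Ia x + Ib x - 2 * Ic x - Id x" if x: "x \<in> \<Omega>" for x
  proof -
    note d = smooth_on_differentiable[OF _ x]
    have "Ia x = ?S x \<bullet> ?R x + v x \<bullet> cl (Y x) (dirac ?S x) - v x \<bullet> cl (Y x) (spin_grad x (v x))"
      by (simp add: Ia_def spin_deriv_cl_dirac[OF x v] inner_diff_right)
    moreover have "Ib x = ?S x \<bullet> ?R x + v x \<bullet> cliff_grad x (?S x) + 2 * (v x \<bullet> flow_deriv ?S x)
        - v x \<bullet> cl (Y x) (dirac ?S x)"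
      by (simp add: Ib_def dirac_cl[OF d[OF smooth_field] d[OF S]] cliff_grad_apply flow_deriv_def
          inner_add_right inner_diff_right)
        (simp add: cl_symmetric inner_commute flip: cl_symmetric[of _ "?S x"])
    moreover have "v x \<bullet> spin_deriv ?S x = v x \<bullet> flow_deriv ?S x + v x \<bullet> spin x (?S x)"
      by (simp add: spin_deriv_def inner_add_right)
    moreover have "Id x = 2 * a x * (?S x \<bullet> v x) + flow_deriv a x * (v x \<bullet> v x)"
    proof -
      have "flow_deriv ?av x = a x *\<^sub>R flow_deriv v x + flow_deriv a x *\<^sub>R v x"
        by (simp add: flow_deriv_def partial_bilinear[OF bounded_bilinear_scaleR d[OF a] d[OF v]]
            scaleR_add_right sum.distrib scaleR_sum_right scaleR_sum_left mult.commute)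
      then have "spin_deriv ?av x = a x *\<^sub>R ?S x + flow_deriv a x *\<^sub>R v x"
        by (simp add: spin_deriv_def blinfun.scaleR_right scaleR_add_right)
      then show ?thesis
        by (simp add: Id_def inner_add_right inner_commute)
    qed
    ultimately show ?thesis
      by (simp add: Ic_def inner_diff_right inner_add_right blinfun.bilinear_simps algebra_simps)
  qed
  have J: "integrable (lebesgue_on \<Omega>) (\<lambda>x. Ia x + Ib x - 2 * Ic x - Id x)"
    using int by simp
  show "integrable (lebesgue_on \<Omega>) ?J"
    by (rule Bochner_Integration.integrable_cong[THEN iffD2, OF refl _ J]) (use pointwise in simp)
  have "?I = (\<integral>x. Ia x + Ib x - 2 * Ic x - Id x \<partial>lebesgue_on \<Omega>)"
    by (rule Bochner_Integration.integral_cong[OF refl]) (use pointwise in simp)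
  then show "?I = 0"
    using int zero by simp
qed

text \<open>The constant \<open>M\<close> depends on the field only. In particular it is independent of \<open>a\<close>, so a
  large \<open>\<kappa>\<close> makes the estimate useful, however large \<open>a\<close> itself is.\<close>
lemma carleman_estimate:
  assumes K: "compact K" "K \<subseteq> \<Omega>" "supported_in K v"
    and v: "smooth_on \<Omega> v" and a: "smooth_on \<Omega> a" and X: "smooth_on \<Omega> X"
    and flow: "\<And>x. x \<in> \<Omega> \<Longrightarrow> flow_deriv a x = \<kappa>"
    and dual: "\<And>x w. x \<in> \<Omega> \<Longrightarrow> cl (Y x) (cl (X x) w) = w"
    and B: "\<And>x. x \<in> \<Omega> \<Longrightarrow> norm (Y x) \<le> B"
    and M1: "\<And>x. x \<in> \<Omega> \<Longrightarrow> norm (Y x) * norm (spin_grad x) \<le> M"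
    and M2: "\<And>x. x \<in> \<Omega> \<Longrightarrow> norm (2 *\<^sub>R spin x - cliff_grad x) \<le> M"
  shows "\<kappa> * (\<integral>x. (norm (v x))\<^sup>2 \<partial>lebesgue_on \<Omega>)
    \<le> B\<^sup>2 * (\<integral>x. (norm (dirac v x - a x *\<^sub>R cl (X x) (v x)))\<^sup>2 \<partial>lebesgue_on \<Omega>)
      + (M + M\<^sup>2) * (\<integral>x. (norm (v x))\<^sup>2 \<partial>lebesgue_on \<Omega>)"
proof -
  let ?J = "\<lambda>x. 2 * (spin_deriv v x \<bullet> (cl (Y x) (dirac v x) - a x *\<^sub>R v x))
      - 2 * (spin_deriv v x \<bullet> spin_deriv v x)
      - v x \<bullet> cl (Y x) (spin_grad x (v x))
      - v x \<bullet> (2 *\<^sub>R spin x - cliff_grad x) (spin_deriv v x)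
      - flow_deriv a x * (v x \<bullet> v x)"
  let ?G = "\<lambda>x. dirac v x - a x *\<^sub>R cl (X x) (v x)"
  note J = integral_multiplier_eq_0[OF K v a]
  have smX: "smooth_on \<Omega> (\<lambda>x. cl (X x) (v x))"
    unfolding cl_apply
    by (intro smooth_on_scaleR smooth_on_sum open_domain smooth_on_gamma v
        smooth_on_linear[OF open_domain bounded_linear_vec_nth X])
  have iv: "integrable (lebesgue_on \<Omega>) (\<lambda>x. (norm (v x))\<^sup>2)"
    by (rule integrable_supported[OF open_domain K(1,2)])
      (use K(3) smooth_on_continuous[OF v] in \<open>auto simp: supported_in_def intro!: continuous_intros\<close>)
  have iG: "integrable (lebesgue_on \<Omega>) (\<lambda>x. (norm (?G x))\<^sup>2)"
    by (rule integrable_supported[OF open_domain K(1,2)])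
      (use K(3) smooth_on_continuous[OF a] smooth_on_continuous[OF smX]
        smooth_on_continuous[OF smooth_on_dirac[OF open_domain v]] supported_in_dirac[OF K(1,3)]
        in \<open>auto simp: supported_in_def blinfun.zero_right intro!: continuous_intros\<close>)
  have pointwise: "?J x \<le> B\<^sup>2 * (norm (?G x))\<^sup>2 + (M + M\<^sup>2) * (norm (v x))\<^sup>2 - \<kappa> * (norm (v x))\<^sup>2"
    if x: "x \<in> \<Omega>" for x
  proof -
    let ?s = "spin_deriv v x"
    define g where "g = cl (Y x) (dirac v x) - a x *\<^sub>R v x"
    have M0: "0 \<le> M"
      using M2[OF x] norm_ge_zero order_trans by blast
    have "g = cl (Y x) (?G x)"
      by (simp add: g_def blinfun.diff_right blinfun.scaleR_right dual[OF x])
    then have "norm g \<le> B * norm (?G x)"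
      using B[OF x] by (simp add: norm_cl mult_right_mono)
    then have g: "(norm g)\<^sup>2 \<le> B\<^sup>2 * (norm (?G x))\<^sup>2"
      using power_mono[of "norm g" "B * norm (?G x)" 2] by (simp add: power_mult_distrib)
    have 1: "2 * (?s \<bullet> g) \<le> (norm ?s)\<^sup>2 + (norm g)\<^sup>2"
      using norm_cauchy_schwarz[of ?s g] sum_squares_bound[of "norm ?s" "norm g"] by linarith
    have "norm (cl (Y x) (spin_grad x (v x))) \<le> M * norm (v x)"
    proof -
      have "norm (cl (Y x) (spin_grad x (v x))) \<le> norm (Y x) * (norm (spin_grad x) * norm (v x))"
        unfolding norm_cl by (intro mult_left_mono norm_blinfun) simp
      also have "\<dots> \<le> M * norm (v x)"
        unfolding mult.assoc[symmetric] by (intro mult_right_mono M1 x) simp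
      finally show ?thesis .
    qed
    then have "norm (v x) * norm (cl (Y x) (spin_grad x (v x))) \<le> norm (v x) * (M * norm (v x))"
      by (intro mult_left_mono) simp_all
    then have 2: "- (v x \<bullet> cl (Y x) (spin_grad x (v x))) \<le> M * (norm (v x))\<^sup>2"
      using Cauchy_Schwarz_ineq2[of "v x" "cl (Y x) (spin_grad x (v x))"]
      by (simp add: power2_eq_square mult.left_commute)
    have "norm ((2 *\<^sub>R spin x - cliff_grad x) ?s) \<le> M * norm ?s"
      using norm_blinfun[of "2 *\<^sub>R spin x - cliff_grad x" ?s] mult_right_mono[OF M2[OF x], of "norm ?s"]
      by simp
    then have "norm (v x) * norm ((2 *\<^sub>R spin x - cliff_grad x) ?s) \<le> norm (v x) * (M * norm ?s)"
      by (intro mult_left_mono) simp_all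
    moreover have "norm (v x) * (M * norm ?s) \<le> (norm ?s)\<^sup>2 + M\<^sup>2 * (norm (v x))\<^sup>2"
    proof -
      have "0 \<le> norm (v x) * (M * norm ?s)"
        using M0 by simp
      moreover have "2 * (norm (v x) * (M * norm ?s)) \<le> (norm ?s)\<^sup>2 + M\<^sup>2 * (norm (v x))\<^sup>2"
        using sum_squares_bound[of "norm ?s" "M * norm (v x)"] by (simp add: power_mult_distrib mult_ac)
      ultimately show ?thesis by linarith
    qed
    ultimately have 3: "- (v x \<bullet> (2 *\<^sub>R spin x - cliff_grad x) ?s) \<le> (norm ?s)\<^sup>2 + M\<^sup>2 * (norm (v x))\<^sup>2"
      using Cauchy_Schwarz_ineq2[of "v x" "(2 *\<^sub>R spin x - cliff_grad x) ?s"] by linarith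
    \<comment> \<open>the two terms with \<open>norm ?s\<close> from 1 and 3 are compensated by the square in \<open>?J\<close>\<close>
    show ?thesis
      using g 1 2 3 unfolding flow[OF x] g_def[symmetric] dot_square_norm by (simp add: distrib_right)
  qed
  have "0 = (\<integral>x. ?J x \<partial>lebesgue_on \<Omega>)"
    using J(2) by simp
  also have "\<dots> \<le> (\<integral>x. B\<^sup>2 * (norm (?G x))\<^sup>2 + (M + M\<^sup>2) * (norm (v x))\<^sup>2 - \<kappa> * (norm (v x))\<^sup>2 \<partial>lebesgue_on \<Omega>)"
    by (rule integral_mono[OF J(1)]) (use iv iG pointwise in simp_all)
  also have "\<dots> = B\<^sup>2 * (\<integral>x. (norm (?G x))\<^sup>2 \<partial>lebesgue_on \<Omega>)
      + (M + M\<^sup>2) * (\<integral>x. (norm (v x))\<^sup>2 \<partial>lebesgue_on \<Omega>) - \<kappa> * (\<integral>x. (norm (v x))\<^sup>2 \<partial>lebesgue_on \<Omega>)"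
    using iv iG by simp
  finally show ?thesis by simp
qed

end

section \<open>Limiting Carleman weights and conformal Killing fields\<close>

text \<open>Scaling turns \<open>char\<close> into an identity for all vectors orthogonal to \<open>X\<close>: the quadratic form
  is a multiple of the norm square there. Together with the values \<open>h X _\<close> this
  determines \<open>h\<close>, by decomposition along \<open>X\<close> and polarization.\<close>
lemma symmetric_form_of_quadratic:
  fixes h :: "'a::real_inner \<Rightarrow> 'a \<Rightarrow> real"
  assumes bil: "bilinear h" and sym: "\<And>\<xi> \<eta>. h \<xi> \<eta> = h \<eta> \<xi>" and X: "X \<noteq> 0"
    and char: "\<And>\<xi>. norm \<xi> = norm X \<Longrightarrow> X \<bullet> \<xi> = 0 \<Longrightarrow> h \<xi> \<xi> + h X X = 0"
  shows "(X \<bullet> X) * h \<xi> \<eta> = h X \<xi> * (X \<bullet> \<eta>) + h X \<eta> * (X \<bullet> \<xi>) - h X X * (\<xi> \<bullet> \<eta>)"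
proof -
  note expand = bilinear_ladd[OF bil] bilinear_radd[OF bil] bilinear_lsub[OF bil] bilinear_rsub[OF bil]
    bilinear_lmul[OF bil] bilinear_rmul[OF bil]
  have \<rho>: "X \<bullet> X > 0"
    using X by simp
  have perp: "(X \<bullet> X) * h \<eta> \<eta> = - (h X X * (\<eta> \<bullet> \<eta>))" if "X \<bullet> \<eta> = 0" for \<eta>
  proof (cases "\<eta> = 0")
    case True
    then show ?thesis using bilinear_lzero[OF bil] by simp
  next
    case False
    let ?r = "norm X / norm \<eta>"
    have "h (?r *\<^sub>R \<eta>) (?r *\<^sub>R \<eta>) + h X X = 0"
      by (rule char) (use False that in auto)
    then have "?r\<^sup>2 * h \<eta> \<eta> + h X X = 0"
      by (simp add: expand power2_eq_square)
    moreover have "?r\<^sup>2 = (X \<bullet> X) / (\<eta> \<bullet> \<eta>)"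
      by (simp add: power_divide power2_norm_eq_inner)
    ultimately have "(X \<bullet> X) / (\<eta> \<bullet> \<eta>) * h \<eta> \<eta> + h X X = 0"
      by (simp only:)
    moreover have "\<eta> \<bullet> \<eta> \<noteq> 0"
      using False by simp
    ultimately show ?thesis
      by (simp add: field_simps)
  qed
  define q where "q \<zeta> = (X \<bullet> X) * h \<zeta> \<zeta> + h X X * (\<zeta> \<bullet> \<zeta>) - 2 * h X \<zeta> * (X \<bullet> \<zeta>)" for \<zeta>
  have q: "q \<zeta> = 0" for \<zeta>
  proof -
    define t where "t = (X \<bullet> \<zeta>) / (X \<bullet> X)"
    define \<eta> where "\<eta> = \<zeta> - t *\<^sub>R X"
    have \<zeta>: "\<zeta> = t *\<^sub>R X + \<eta>"
      by (simp add: \<eta>_def)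
    have \<eta>: "X \<bullet> \<eta> = 0"
      using \<rho> by (simp add: \<eta>_def t_def inner_diff_right)
    show ?thesis
      unfolding q_def \<zeta> using perp[OF \<eta>] \<eta>
      by (simp add: expand inner_add_left inner_add_right inner_commute[of \<eta> X] sym[of \<eta> X])
        (simp add: algebra_simps)
  qed
  have "q (\<xi> + \<eta>) - q \<xi> - q \<eta>
      = 2 * ((X \<bullet> X) * h \<xi> \<eta> - (h X \<xi> * (X \<bullet> \<eta>) + h X \<eta> * (X \<bullet> \<xi>) - h X X * (\<xi> \<bullet> \<eta>)))"
    by (simp add: q_def expand inner_add_left inner_add_right inner_commute[of \<eta> \<xi>] sym[of \<eta> \<xi>])
      (simp add: algebra_simps)
  then show ?thesis
    using q by simp
qed

lemma smooth_on_grad: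
  fixes f :: "real^'n \<Rightarrow> real"
  assumes "open S" "smooth_on S f"
  shows "smooth_on S (grad f)"
proof -
  have "grad f = (\<lambda>x. \<Sum>k\<in>UNIV. partial k f x *\<^sub>R axis k 1)"
    by (simp add: fun_eq_iff grad_def vec_eq_iff axis_def if_distrib cong: if_cong)
  then show ?thesis
    using assms by (auto intro!: smooth_on_sum smooth_on_scaleR smooth_on_partial smooth_on_const)
qed

lemma partial_grad:
  fixes f :: "real^'n \<Rightarrow> real"
  assumes "open S" "smooth_on S f" "x \<in> S"
  shows "partial m (grad f) x $ k = partial m (partial k f) x"
proof -
  have "partial m (\<lambda>y. grad f y $ k) x = partial m (grad f) x $ k"
    by (rule partial_linear[OF bounded_linear_vec_nth smooth_on_differentiable[OF smooth_on_grad]])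
      (use assms in auto)
  then show ?thesis
    by (simp add: grad_def)
qed

lemma partial_id [simp]: "partial k (\<lambda>x. x) x = axis k 1"
  by (rule partial_unique) (rule has_derivative_ident)

text \<open>Both sums are values of the Hessian of \<open>\<phi>\<close> as a quadratic form, at \<open>\<xi>\<close> and at the gradient.\<close>
lemma poisson_bracket_symbols:
  fixes \<phi> :: "real^'n \<Rightarrow> real"
  assumes "open U" "smooth_on U \<phi>" "x \<in> U"
  shows "poisson_bracket (re_symbol \<phi>) (im_symbol \<phi>) x \<xi>
    = 4 * ((\<Sum>m\<in>UNIV. \<xi> $ m * (partial m (grad \<phi>) x \<bullet> \<xi>))
      + (\<Sum>m\<in>UNIV. grad \<phi> x $ m * (partial m (grad \<phi>) x \<bullet> grad \<phi> x)))"
proof -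
  have X: "grad \<phi> differentiable (at x)"
    using smooth_on_differentiable[OF smooth_on_grad[OF assms(1,2)] assms(3)] .
  have 1: "partial m (\<lambda>\<eta>. re_symbol \<phi> x \<eta>) \<xi> = 2 * \<xi> $ m" for m
  proof -
    have "((\<lambda>\<eta>. \<eta> \<bullet> \<eta> - grad \<phi> x \<bullet> grad \<phi> x) has_derivative (\<lambda>d. 2 * (\<xi> \<bullet> d))) (at \<xi>)"
      by (auto intro!: derivative_eq_intros simp: inner_commute)
    from partial_unique[OF this, of m] show ?thesis
      by (simp add: re_symbol_def power2_norm_eq_inner inner_axis)
  qed
  have 2: "partial m (\<lambda>y. im_symbol \<phi> y \<xi>) x = 2 * (partial m (grad \<phi>) x \<bullet> \<xi>)" for m
  proof -
    have bl: "bounded_linear (\<lambda>a::real^'n. 2 * (a \<bullet> \<xi>))"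
      by (intro bounded_linear_mult_right[THEN bounded_linear_compose] bounded_linear_inner_left)
    show ?thesis
      unfolding im_symbol_def using partial_linear[OF bl X] .
  qed
  have 3: "partial m (\<lambda>y. re_symbol \<phi> y \<xi>) x = - 2 * (partial m (grad \<phi>) x \<bullet> grad \<phi> x)" for m
  proof -
    have c: "(\<lambda>y::real^'n. \<xi> \<bullet> \<xi>) differentiable (at x)"
      by simp
    have XX: "(\<lambda>y. - (grad \<phi> y \<bullet> grad \<phi> y)) differentiable (at x)"
      using X by (intro differentiable_minus) (auto intro: differentiable_inner)
    have "partial m (\<lambda>y. grad \<phi> y \<bullet> grad \<phi> y) x = 2 * (partial m (grad \<phi>) x \<bullet> grad \<phi> x)"
      by (simp add: partial_bilinear[OF bounded_bilinear_inner X X] inner_commute)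
    moreover have "(\<lambda>y. grad \<phi> y \<bullet> grad \<phi> y) differentiable (at x)"
      using X by (auto intro: differentiable_inner)
    ultimately have "partial m (\<lambda>y. - (grad \<phi> y \<bullet> grad \<phi> y)) x = - 2 * (partial m (grad \<phi>) x \<bullet> grad \<phi> x)"
      by (simp add: partial_linear[OF bounded_linear_minus[OF bounded_linear_ident]])
    then show ?thesis
      using partial_add[OF c XX, of m] by (simp add: re_symbol_def power2_norm_eq_inner)
  qed
  have 4: "partial m (\<lambda>\<eta>. im_symbol \<phi> x \<eta>) \<xi> = 2 * grad \<phi> x $ m" for m
  proof -
    have bl: "bounded_linear (\<lambda>a::real^'n. 2 * (grad \<phi> x \<bullet> a))"
      by (intro bounded_linear_mult_right[THEN bounded_linear_compose] bounded_linear_inner_right)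
    show ?thesis
      unfolding im_symbol_def using partial_linear[OF bl, of "\<lambda>x. x" \<xi> m] by (simp add: inner_axis)
  qed
  show ?thesis
    unfolding poisson_bracket_def grad_def[of "\<lambda>\<eta>. re_symbol \<phi> x \<eta>"] grad_def[of "\<lambda>y. im_symbol \<phi> y \<xi>"]
      grad_def[of "\<lambda>y. re_symbol \<phi> y \<xi>"] grad_def[of "\<lambda>\<eta>. im_symbol \<phi> x \<eta>"]
      inner_vec_def[where 'b = 'n and 'a = real, of "vec_lambda _" "vec_lambda _"] vec_lambda_beta 1 2 3 4
    by (simp add: sum_distrib_left sum_negf algebra_simps flip: sum.distrib)
qed

definition inverted_grad :: "(real^'n \<Rightarrow> real) \<Rightarrow> real^'n \<Rightarrow> real^'n" where
  "inverted_grad \<phi> x = inverse (grad \<phi> x \<bullet> grad \<phi> x) *\<^sub>R grad \<phi> x"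

lemma smooth_on_inverted_grad:
  assumes "open U" "limiting_carleman_weight U \<phi>"
  shows "smooth_on U (inverted_grad \<phi>)"
  using assms unfolding inverted_grad_def[abs_def] limiting_carleman_weight_def
  by (intro smooth_on_scaleR smooth_on_inverse smooth_on_inner smooth_on_grad) auto

text \<open>The limiting Carleman condition determines the Hessian \<open>h\<close> as in \<open>symmetric_form_of_quadratic\<close>:
  it is a multiple of the identity plus a symmetrized product of the gradient with
  \<open>h X _\<close>. Dividing the gradient by its norm square adds to the derivative exactly
  the terms that remove this product after symmetrization.\<close>
lemma inverted_grad_conformal:
  fixes \<phi> :: "real^'n \<Rightarrow> real"
  assumes U: "open U" "limiting_carleman_weight U \<phi>" "x \<in> U"
  defines "\<sigma> \<equiv> - (\<Sum>m\<in>UNIV. grad \<phi> x $ m * (partial m (grad \<phi>) x \<bullet> grad \<phi> x))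
      / (grad \<phi> x \<bullet> grad \<phi> x)\<^sup>2"
  shows "partial m (inverted_grad \<phi>) x $ k + partial k (inverted_grad \<phi>) x $ m
    = (if m = k then 2 * \<sigma> else 0)"
proof -
  have sm: "smooth_on U \<phi>" and X0: "grad \<phi> x \<noteq> 0"
    and lcw: "\<And>\<xi>. re_symbol \<phi> x \<xi> = 0 \<Longrightarrow> im_symbol \<phi> x \<xi> = 0 \<Longrightarrow>
      poisson_bracket (re_symbol \<phi>) (im_symbol \<phi>) x \<xi> = 0"
    using U unfolding limiting_carleman_weight_def by auto
  define X where "X = grad \<phi> x"
  define h where "h \<xi> \<eta> = (\<Sum>m\<in>UNIV. \<xi> $ m * (partial m (grad \<phi>) x \<bullet> \<eta>))" for \<xi> \<eta>
  have hess: "partial m (grad \<phi>) x $ k = partial k (grad \<phi>) x $ m" for m k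
    using partial_commute[OF U(1) sm U(3)] by (simp add: partial_grad[OF U(1) sm U(3)])
  have h_axis: "h (axis m 1) \<eta> = partial m (grad \<phi>) x \<bullet> \<eta>" for m \<eta>
    by (simp add: h_def axis_def if_distrib if_distribR cong: if_cong)
  have bil: "bilinear h"
    unfolding bilinear_def h_def
    by (auto intro!: linearI simp: sum.distrib inner_add_right algebra_simps sum_distrib_left)
  have sym: "h \<xi> \<eta> = h \<eta> \<xi>" for \<xi> \<eta>
  proof -
    have "h \<xi> \<eta> = (\<Sum>m\<in>UNIV. \<Sum>k\<in>UNIV. \<xi> $ m * (partial m (grad \<phi>) x $ k * \<eta> $ k))"
      by (simp add: h_def inner_vec_def sum_distrib_left)
    also have "\<dots> = (\<Sum>k\<in>UNIV. \<Sum>m\<in>UNIV. \<xi> $ m * (partial m (grad \<phi>) x $ k * \<eta> $ k))"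
      by (rule sum.swap)
    also have "\<dots> = h \<eta> \<xi>"
      by (simp add: h_def inner_vec_def sum_distrib_left hess mult_ac)
    finally show ?thesis .
  qed
  have char: "h \<xi> \<xi> + h X X = 0" if "norm \<xi> = norm X" "X \<bullet> \<xi> = 0" for \<xi>
    using lcw[of \<xi>] that poisson_bracket_symbols[OF U(1) sm U(3), of \<xi>]
    by (simp add: re_symbol_def im_symbol_def X_def h_def)
  note form = symmetric_form_of_quadratic[OF bil sym X0[folded X_def] char]
  have d: "grad \<phi> differentiable (at x)"
    using smooth_on_differentiable[OF smooth_on_grad[OF U(1) sm] U(3)] .
  have dXX: "(\<lambda>y. grad \<phi> y \<bullet> grad \<phi> y) differentiable (at x)"
    using d by (auto intro: differentiable_inner)
  have dinv: "(\<lambda>y. inverse (grad \<phi> y \<bullet> grad \<phi> y)) differentiable (at x)"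
    using dXX X0 by (intro differentiable_inverse) auto
  have "partial m (\<lambda>y. inverse (grad \<phi> y \<bullet> grad \<phi> y)) x
      = - (inverse (X \<bullet> X) * inverse (X \<bullet> X)) * (2 * h (axis m 1) X)" for m
    using X0 by (subst partial_real_chain[OF _ dXX, where F' = "- (inverse (X \<bullet> X) * inverse (X \<bullet> X))"])
      (auto intro!: derivative_eq_intros
        simp: X_def partial_bilinear[OF bounded_bilinear_inner d d] h_axis inner_commute)
  then have "partial m (inverted_grad \<phi>) x
      = inverse (X \<bullet> X) *\<^sub>R partial m (grad \<phi>) x
        + (- (inverse (X \<bullet> X) * inverse (X \<bullet> X)) * (2 * h (axis m 1) X)) *\<^sub>R X" for m
    unfolding inverted_grad_def[abs_def]
    by (simp add: partial_bilinear[OF bounded_bilinear_scaleR dinv d] X_def)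
  then have "partial m (inverted_grad \<phi>) x $ k
      = inverse (X \<bullet> X) * h (axis m 1) (axis k 1) - 2 * (inverse (X \<bullet> X))\<^sup>2 * h X (axis m 1) * X $ k" for m k
    by (simp add: h_axis inner_axis power2_eq_square sym[of X])
  moreover have "r\<^sup>2 * (inverse r * p - 2 * (inverse r)\<^sup>2 * c * e) = r * p - 2 * c * e" if "r \<noteq> 0" for r p c e :: real
    using that by (simp add: field_simps power2_eq_square)
  ultimately have P: "(X \<bullet> X)\<^sup>2 * partial m (inverted_grad \<phi>) x $ k
      = (X \<bullet> X) * h (axis m 1) (axis k 1) - 2 * h X (axis m 1) * X $ k" for m k
    using X0[folded X_def] by simp
  have "(X \<bullet> X)\<^sup>2 * (partial m (inverted_grad \<phi>) x $ k + partial k (inverted_grad \<phi>) x $ m)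
      = 2 * ((X \<bullet> X) * h (axis m 1) (axis k 1) - h X (axis m 1) * X $ k - h X (axis k 1) * X $ m)"
    unfolding distrib_left[of "(X \<bullet> X)\<^sup>2"] P by (simp add: sym[of "axis k 1" "axis m 1"])
  also have "\<dots> = - 2 * h X X * (if m = k then 1 else 0)"
    using form[of "axis m 1" "axis k 1"] inner_axis_axis[of m "1::real" k 1]
    by (auto simp: inner_axis(1) right_diff_distrib distrib_left)
  finally have "partial m (inverted_grad \<phi>) x $ k + partial k (inverted_grad \<phi>) x $ m
      = - 2 * h X X * (if m = k then 1 else 0) / (X \<bullet> X)\<^sup>2"
    using X0[folded X_def] by (subst nonzero_eq_divide_eq) (simp_all add: mult.commute)
  then show ?thesis
    by (simp add: \<sigma>_def h_def X_def)
qed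

section \<open>Dirac operators as Clifford actions\<close>

lemma matrix_vector_mult_scaleR:
  fixes M :: "complex^'n^'m"
  shows "M *v (r *\<^sub>R v) = r *\<^sub>R (M *v v)"
  by (simp add: vec_eq_iff matrix_vector_mult_def scaleR_sum_right)

lemma bounded_linear_matrix_vector_mult:
  fixes M :: "complex^'n^'m"
  shows "bounded_linear ((*v) M)"
  by (intro linear_conv_bounded_linear[THEN iffD1] linearI)
    (simp_all add: matrix_vector_right_distrib matrix_vector_mult_scaleR)

lemma symbol_axis [simp]: "symbol A (axis j 1) = A j"
proof -
  have "A k $ i $ l * complex_of_real (axis j 1 $ k) = (if k = j then A k $ i $ l else 0)" for k i l
    by (simp add: axis_def)
  then show ?thesis
    by (simp add: symbol_def vec_eq_iff)
qed

lemma symbol_add: "symbol A (\<xi> + \<eta>) = symbol A \<xi> + symbol A \<eta>"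
  by (simp add: symbol_def vec_eq_iff distrib_left sum.distrib)

text \<open>The inner product of \<open>complex^'N\<close> is the real part of the Hermitian one.\<close>
lemma hermitian_inner:
  fixes M :: "complex^'N^'N"
  assumes "map_matrix cnj (transpose M) = M"
  shows "(M *v v) \<bullet> w = v \<bullet> (M *v w)"
proof -
  have herm: "cnj (M $ i $ j) = M $ j $ i" for i j
    using arg_cong[OF assms, of "\<lambda>m. m $ j $ i"] by (simp add: map_matrix_def transpose_def)
  have adj: "(a * b) \<bullet> c = b \<bullet> (cnj a * c)" for a b c :: complex
    by (simp add: inner_complex_def algebra_simps)
  have "(M *v v) \<bullet> w = (\<Sum>i\<in>UNIV. \<Sum>j\<in>UNIV. v $ j \<bullet> (M $ j $ i * w $ i))"
    by (simp add: inner_vec_def matrix_vector_mult_def inner_sum_left adj herm)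
  also have "\<dots> = (\<Sum>j\<in>UNIV. \<Sum>i\<in>UNIV. v $ j \<bullet> (M $ j $ i * w $ i))"
    by (rule sum.swap)
  also have "\<dots> = v \<bullet> (M *v w)"
    by (simp add: inner_vec_def matrix_vector_mult_def inner_sum_right)
  finally show ?thesis .
qed

definition mat_blinfun :: "complex^'N^'N \<Rightarrow> (complex^'N) \<Rightarrow>\<^sub>L (complex^'N)" where
  "mat_blinfun M = Blinfun ((*v) M)"

lemma mat_blinfun_apply [simp]: "mat_blinfun M v = M *v v"
  by (simp add: mat_blinfun_def bounded_linear_Blinfun_apply bounded_linear_matrix_vector_mult)

text \<open>The Clifford relations are the polarization of \<open>P\<^sub>0(\<xi>)\<^sup>2 = \<bar>\<xi>\<bar>\<^sup>2\<close>, evaluated at sums of two basis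
  vectors.\<close>
lemma dirac_operator_clifford_action:
  fixes A :: "'n::finite \<Rightarrow> complex^'N^'N"
  assumes "dirac_operator A"
  shows "clifford_action (\<lambda>k. mat_blinfun (A k))"
proof
  fix j k :: 'n and v w :: "complex^'N"
  have herm: "map_matrix cnj (transpose (symbol A \<xi>)) = symbol A \<xi>"
    and sq: "symbol A \<xi> ** symbol A \<xi> = mat (complex_of_real ((norm \<xi>)\<^sup>2))" for \<xi> :: "real^'n"
    using assms unfolding dirac_operator_def by auto
  show "mat_blinfun (A j) v \<bullet> w = v \<bullet> mat_blinfun (A j) w"
    using hermitian_inner[OF herm[of "axis j 1"]] by simp
  have sq': "symbol A \<xi> *v (symbol A \<xi> *v v) = (\<xi> \<bullet> \<xi>) *\<^sub>R v" for \<xi> :: "real^'n"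
  proof -
    have "symbol A \<xi> *v (symbol A \<xi> *v v) = mat (complex_of_real (\<xi> \<bullet> \<xi>)) *v v"
      by (simp add: matrix_vector_mul_assoc sq power2_norm_eq_inner)
    also have "\<dots> = (\<xi> \<bullet> \<xi>) *\<^sub>R v"
      by (simp add: vec_eq_iff matrix_vector_mult_def mat_def if_distrib if_distribR
          scaleR_conv_of_real[where 'a = complex] cong: if_cong)
    finally show ?thesis .
  qed
  let ?j = "axis j (1::real)" and ?k = "axis k (1::real)"
  have "(A j + A k) *v ((A j + A k) *v v) = ((?j + ?k) \<bullet> (?j + ?k)) *\<^sub>R v"
    using sq'[of "?j + ?k"] by (simp add: symbol_add)
  moreover have "A j *v (A j *v v) = v" "A k *v (A k *v v) = v"
    using sq'[of ?j] sq'[of ?k] by (simp_all add: inner_axis_axis)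
  moreover have "(?j + ?k) \<bullet> (?j + ?k) = 2 + (if j = k then 2 else 0)"
    by (simp add: inner_add_left inner_add_right inner_axis_axis)
  ultimately have "v + A k *v (A j *v v) + (A j *v (A k *v v) + v) = 2 *\<^sub>R v + (if j = k then 2 else 0) *\<^sub>R v"
    by (simp add: matrix_vector_mult_add_rdistrib matrix_vector_right_distrib scaleR_add_left)
  then show "mat_blinfun (A j) (mat_blinfun (A k) v) + mat_blinfun (A k) (mat_blinfun (A j) v)
      = (if j = k then 2 else 0) *\<^sub>R v"
    by (simp add: scaleR_2 add_ac)
qed

lemma semiclassical_op_eq_dirac:
  assumes "dirac_operator A"
  shows "semiclassical_op A h w x
    = (- \<i> * complex_of_real h) *s clifford_action.dirac (\<lambda>k. mat_blinfun (A k)) w x"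
proof -
  interpret clifford_action "\<lambda>k. mat_blinfun (A k)"
    by (rule dirac_operator_clifford_action[OF assms])
  have "M *v (c *s v) = c *s (M *v v)" for M :: "complex^'b^'b" and c v
    by (simp add: vec_eq_iff matrix_vector_mult_def sum_distrib_left mult.left_commute)
  moreover have "(\<Sum>k\<in>UNIV. c *s f k) = c *s (\<Sum>k\<in>UNIV. f k)" for c and f :: "'a \<Rightarrow> complex^'b"
    by (simp add: vec_eq_iff sum_distrib_left)
  ultimately show ?thesis
    by (simp only: semiclassical_op_def dirac_def mat_blinfun_apply)
qed

lemma norm_smult_vec: "norm (c *s v) = norm c * norm (v :: complex^'N)"
  by (simp add: norm_vec_def norm_mult L2_set_right_distrib)

section \<open>The Carleman estimate for Dirac operators\<close>

lemma compact_bound: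
  fixes f :: "'a::t2_space \<Rightarrow> 'b::real_normed_vector"
  assumes "compact C" "continuous_on C f"
  obtains B where "B > 0" "\<And>x. x \<in> C \<Longrightarrow> norm (f x) \<le> B"
  using compact_imp_bounded[OF compact_continuous_image[OF assms(2,1)]]
  unfolding bounded_pos by auto

lemma norm_square_measurable:
  fixes f :: "'a \<Rightarrow> complex^'N"
  assumes "\<And>i. (\<lambda>x. f x $ i) \<in> borel_measurable M"
  shows "(\<lambda>x. (norm (f x))\<^sup>2) \<in> borel_measurable M"
proof -
  have "(\<lambda>x. (norm (f x))\<^sup>2) = (\<lambda>x. \<Sum>i\<in>UNIV. (norm (f x $ i))\<^sup>2)"
    by (simp add: norm_vec_def L2_set_def sum_nonneg)
  then show ?thesis
    using assms by simp
qed

lemma Linfty_matrix_bound: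
  fixes V :: "real^'n \<Rightarrow> complex^'N^'N"
  assumes "\<forall>i j. (\<lambda>x. V x $ i $ j) \<in> Linfty \<Omega>"
  obtains M where "M \<ge> 0" "AE x in lebesgue_on \<Omega>. \<forall>w. norm (V x *v w) \<le> M * norm w"
proof -
  have "\<forall>i j. \<exists>m. AE x in lebesgue_on \<Omega>. norm (V x $ i $ j) \<le> m"
    using assms by (auto simp: Linfty_def)
  then obtain m where m: "\<And>i j. AE x in lebesgue_on \<Omega>. norm (V x $ i $ j) \<le> m i j"
    by metis
  have "AE x in lebesgue_on \<Omega>. \<forall>i\<in>UNIV. \<forall>j\<in>UNIV. norm (V x $ i $ j) \<le> m i j"
    by (intro AE_finite_allI m) simp_all
  then have "AE x in lebesgue_on \<Omega>. \<forall>w. norm (V x *v w) \<le> (\<Sum>i\<in>UNIV. \<Sum>j\<in>UNIV. \<bar>m i j\<bar>) * norm w"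
  proof (rule AE_mp, intro AE_I2 impI allI)
    fix x and w :: "complex^'N"
    assume V: "\<forall>i\<in>UNIV. \<forall>j\<in>UNIV. norm (V x $ i $ j) \<le> m i j"
    have "norm (V x *v w) \<le> (\<Sum>i\<in>UNIV. norm ((V x *v w) $ i))"
      unfolding norm_vec_def by (rule L2_set_le_sum) simp
    also have "\<dots> \<le> (\<Sum>i\<in>UNIV. \<Sum>j\<in>UNIV. \<bar>m i j\<bar> * norm w)"
    proof (intro sum_mono)
      fix i
      have "norm ((V x *v w) $ i) \<le> (\<Sum>j\<in>UNIV. norm (V x $ i $ j * w $ j))"
        by (simp add: matrix_vector_mult_def norm_sum)
      also have "\<dots> \<le> (\<Sum>j\<in>UNIV. \<bar>m i j\<bar> * norm w)"
        unfolding norm_mult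
        by (intro sum_mono mult_mono Finite_Cartesian_Product.norm_nth_le)
          (use V abs_ge_self order_trans in \<open>blast, auto\<close>)
      finally show "norm ((V x *v w) $ i) \<le> (\<Sum>j\<in>UNIV. \<bar>m i j\<bar> * norm w)" .
    qed
    finally show "norm (V x *v w) \<le> (\<Sum>i\<in>UNIV. \<Sum>j\<in>UNIV. \<bar>m i j\<bar>) * norm w"
      by (simp add: sum_distrib_right)
  qed
  then show thesis
    using that[of "\<Sum>i\<in>UNIV. \<Sum>j\<in>UNIV. \<bar>m i j\<bar>"] by (simp add: sum_nonneg)
qed

lemma grad_chain:
  fixes F :: "real \<Rightarrow> real"
  assumes "(F has_real_derivative F') (at (\<phi> x))" "\<phi> differentiable (at x)"
  shows "grad (\<lambda>y. F (\<phi> y)) x = F' *\<^sub>R grad \<phi> x"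
  by (simp add: grad_def vec_eq_iff partial_real_chain[where f = \<phi>, OF assms])

text \<open>Conjugation by the exponential weight shifts the Dirac operator by Clifford multiplication with
  \<open>grad \<phi> / h\<close>.\<close>
lemma conjugated_op_eq:
  assumes A: "dirac_operator A" and h: "h \<noteq> 0"
    and \<phi>: "\<phi> differentiable (at x)" and u: "u differentiable (at x)"
  shows "conjugated_op A V \<phi> h u x
    = (- \<i> * complex_of_real h) *s (clifford_action.dirac (\<lambda>k. mat_blinfun (A k)) u x
        - (1/h) *\<^sub>R clifford_action.cl (\<lambda>k. mat_blinfun (A k)) (grad \<phi> x) (u x))
      + h *\<^sub>R (V x *v u x)"
proof -
  interpret clifford_action "\<lambda>k. mat_blinfun (A k)"
    by (rule dirac_operator_clifford_action[OF A])
  let ?e = "exp (- \<phi> x / h)"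
  have der: "((\<lambda>s. exp (- s / h)) has_real_derivative - ?e / h) (at (\<phi> x))"
    using h by (auto intro!: derivative_eq_intros)
  have de: "(\<lambda>y. exp (- \<phi> y / h)) differentiable (at x)"
  proof -
    have "((\<lambda>s. exp (- s / h)) has_derivative (*) (- ?e / h)) (at (\<phi> x))"
      using der has_field_derivative_def by blast
    then show ?thesis
      using \<phi> has_derivative_compose[of \<phi> _ x UNIV "\<lambda>s. exp (- s / h)"]
      unfolding differentiable_def by blast
  qed
  have "dirac (\<lambda>y. exp (- \<phi> y / h) *\<^sub>R u y) x
      = ?e *\<^sub>R (dirac u x - (1/h) *\<^sub>R cl (grad \<phi> x) (u x))"
    unfolding dirac_scaleR[OF de u] grad_chain[OF der \<phi>] cl_scaleR by (simp add: scaleR_diff_right)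
  moreover have "c *s (r *\<^sub>R w) = r *\<^sub>R (c *s w)" for c r and w :: "complex^'b"
    by (simp add: vec_eq_iff)
  moreover have "exp (\<phi> x / h) *\<^sub>R ?e *\<^sub>R w = w" for w :: "complex^'b"
    by (simp flip: exp_add)
  ultimately show ?thesis
    by (simp only: conjugated_op_def Let_def semiclassical_op_eq_dirac[OF A] matrix_vector_mult_scaleR
        scaleR_add_right scaleR_left_commute[of "exp (\<phi> x / h)" h])
qed


theorem theorem1p1:
  fixes \<Omega> \<Omega>' :: "(real^'n) set"
    and A :: "'n \<Rightarrow> complex^'N^'N"
    and V :: "real^'n \<Rightarrow> complex^'N^'N"
    and \<phi> :: "real^'n \<Rightarrow> real"
  assumes "CARD('n) \<ge> 2"
    and "open \<Omega>" and "bounded \<Omega>"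
    and "dirac_operator A"
    and "\<forall>i j. (\<lambda>x. V x $ i $ j) \<in> Linfty \<Omega>"
    and "open \<Omega>'" and "closure \<Omega> \<subseteq> \<Omega>'"
    and "limiting_carleman_weight \<Omega>' \<phi>"
  shows "\<exists>h0>0. \<exists>C>0. \<forall>h. 0 < h \<and> h \<le> h0 \<longrightarrow>
           (\<forall>u::real^'n \<Rightarrow> complex^'N. u \<in> test_functions \<Omega> \<longrightarrow>
              h * L2norm \<Omega> u + h\<^sup>2 * L2norm \<Omega> (grad u)
                \<le> C * L2norm \<Omega> (conjugated_op A V \<phi> h u))"
proof -
  let ?\<gamma> = "\<lambda>k. mat_blinfun (A k)"
  define X where "X = grad \<phi>"
  define Y where "Y = inverted_grad \<phi>"
  define \<sigma> where "\<sigma> x = - (\<Sum>m\<in>UNIV. grad \<phi> x $ m * (partial m (grad \<phi>) x \<bullet> grad \<phi> x))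
      / (grad \<phi> x \<bullet> grad \<phi> x)\<^sup>2" for x
  have sub: "\<Omega> \<subseteq> \<Omega>'"
    using assms(7) closure_subset by blast
  have sm': "smooth_on \<Omega>' \<phi>" and X0: "\<And>x. x \<in> \<Omega> \<Longrightarrow> X x \<noteq> 0"
    using assms(8) sub by (auto simp: limiting_carleman_weight_def X_def)
  have sm: "smooth_on \<Omega> \<phi>"
    by (rule smooth_on_subset[OF sm' sub])
  have smX': "smooth_on \<Omega>' X" and smX: "smooth_on \<Omega> X"
    unfolding X_def by (rule smooth_on_grad[OF assms(6) sm'] smooth_on_grad[OF assms(2) sm])+
  have smY': "smooth_on \<Omega>' Y"
    unfolding Y_def by (rule smooth_on_inverted_grad[OF assms(6,8)])
  \<comment> \<open>the field is considered on \<open>\<Omega>'\<close> as well, where its coefficients are bounded on the closure of \<open>\<Omega>\<close>\<close>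
  have conf: "partial m Y x $ k + partial k Y x $ m = (if m = k then 2 * \<sigma> x else 0)"
    if "x \<in> \<Omega>'" for m k x
    unfolding Y_def \<sigma>_def by (rule inverted_grad_conformal[OF assms(6,8) that])
  interpret clifford_action ?\<gamma>
    by (rule dirac_operator_clifford_action[OF assms(4)])
  interpret big: conformal_killing_field ?\<gamma> \<Omega>' Y \<sigma>
    by (intro conformal_killing_field.intro dirac_operator_clifford_action assms
        conformal_killing_field_axioms.intro smY' conf)
  interpret conformal_killing_field ?\<gamma> \<Omega> Y \<sigma>
    by (intro conformal_killing_field.intro dirac_operator_clifford_action assms
        conformal_killing_field_axioms.intro smooth_on_subset[OF smY' sub] conf)
      (use sub in auto)

  have comp: "compact (closure \<Omega>)"
    using assms(3) by simp
  note bound = compact_bound[OF comp continuous_on_subset[OF _ assms(7)]]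
  obtain L where L: "L > 0" "\<And>x. x \<in> closure \<Omega> \<Longrightarrow> norm (X x) \<le> L"
    using bound[OF smooth_on_continuous[OF smX']] by blast
  obtain P where P: "P > 0" "\<And>x. x \<in> closure \<Omega> \<Longrightarrow> norm (\<phi> x) \<le> P"
    using bound[OF smooth_on_continuous[OF sm']] by blast
  obtain B where B: "B > 0" "\<And>x. x \<in> closure \<Omega> \<Longrightarrow> norm (Y x) \<le> B"
    using bound[OF smooth_on_continuous[OF smY']] by blast
  have "continuous_on \<Omega>' spin_grad"
    unfolding spin_grad_def[abs_def]
    by (intro continuous_intros bounded_bilinear.continuous_on[OF bounded_bilinear_blinfun_compose]
        smooth_on_continuous smooth_on_partial big.smooth_on_spin)
  then have "continuous_on \<Omega>' (\<lambda>x. norm (Y x) * norm (spin_grad x))"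
    using smooth_on_continuous[OF smY'] by (intro continuous_intros)
  then obtain M1 where M1: "M1 > 0" "\<And>x. x \<in> closure \<Omega> \<Longrightarrow> norm (norm (Y x) * norm (spin_grad x)) \<le> M1"
    using bound by blast
  have "continuous_on \<Omega>' (\<lambda>x. 2 *\<^sub>R spin x - cliff_grad x)"
    unfolding cliff_grad_def
    by (intro continuous_intros smooth_on_continuous big.smooth_on_spin big.smooth_on_partial_component)
  then obtain M2 where M2: "M2 > 0" "\<And>x. x \<in> closure \<Omega> \<Longrightarrow> norm (2 *\<^sub>R spin x - cliff_grad x) \<le> M2"
    using bound by blast
  define M where "M = max M1 M2"
  have M: "norm (Y x) * norm (spin_grad x) \<le> M" "norm (2 *\<^sub>R spin x - cliff_grad x) \<le> M" "norm (Y x) \<le> B"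
    if "x \<in> \<Omega>" for x
    using M1(2)[of x] M2(2)[of x] B(2)[of x] that closure_subset[of \<Omega>] by (auto simp: M_def)
  obtain MV where MV: "MV \<ge> 0" "AE x in lebesgue_on \<Omega>. \<forall>w. norm (V x *v w) \<le> MV * norm w"
    using Linfty_matrix_bound[OF assms(5)] .

  \<comment> \<open>\<open>\<kappa>\<close> exceeds the error constant of \<open>carleman_estimate\<close>, and the last summand absorbs \<open>V\<close>; the choice
    does not involve \<open>h\<close>\<close>
  define \<kappa> where "\<kappa> = 1 + M + M\<^sup>2 + 2 * B\<^sup>2 * MV\<^sup>2"
  define E where "E = exp (\<kappa> * P\<^sup>2 / 2)"
  define c1 where "c1 = sqrt 2 * B * E"
  define c2 where "c2 = sqrt (2 + 2 * (L + MV)\<^sup>2 * c1\<^sup>2)"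
  have "\<kappa> \<ge> 0"
    using M1(1) by (simp add: \<kappa>_def M_def add_nonneg_nonneg)

  have main: "h * L2norm \<Omega> u \<le> c1 * L2norm \<Omega> (conjugated_op A V \<phi> h u)
      \<and> h\<^sup>2 * L2norm \<Omega> (grad u) \<le> c2 * L2norm \<Omega> (conjugated_op A V \<phi> h u)"
    if h: "0 < h" "h \<le> 1" and test: "u \<in> test_functions \<Omega>" for h and u :: "real^'n \<Rightarrow> complex^'N"
  proof -
    define K where "K = closure {x. u x \<noteq> 0}"
    have K: "compact K" "K \<subseteq> \<Omega>" and u: "smooth_on \<Omega> u"
      using test smooth_on_subset[of UNIV u \<Omega>] by (auto simp: test_functions_def K_def)
    have supu: "supported_in K u"
      using closure_subset[of "{x. u x \<noteq> 0}"] by (auto simp: supported_in_def K_def)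
    note intsup = integrable_supported[OF assms(2) K]
    \<comment> \<open>\<open>G\<close> is the conjugated operator without potential, divided by \<open>- \<i> * h\<close>\<close>
    define G where "G x = dirac u x - (1/h) *\<^sub>R cl (X x) (u x)" for x
    define p where "p = conjugated_op A V \<phi> h u"
    have smclX: "smooth_on \<Omega> (\<lambda>x. cl (X x) (u x))"
      unfolding cl_apply
      by (intro smooth_on_scaleR smooth_on_sum assms(2) smooth_on_gamma u
          smooth_on_linear[OF assms(2) bounded_linear_vec_nth smX])
    have contG: "continuous_on \<Omega> G"
      unfolding G_def[abs_def]
      by (intro continuous_intros smooth_on_continuous[OF smclX]
          smooth_on_continuous[OF smooth_on_dirac[OF assms(2) u]])
    have supG: "supported_in K G"
      using supported_in_dirac[OF K(1) supu] supu
      by (auto simp: supported_in_def G_def blinfun.zero_right)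
    have p: "p x = (- \<i> * complex_of_real h) *s G x + h *\<^sub>R (V x *v u x)" if "x \<in> \<Omega>" for x
      unfolding p_def G_def X_def
      by (rule conjugated_op_eq[OF assms(4)])
        (use h smooth_on_differentiable[OF sm that] smooth_on_differentiable[OF u that] in auto)

    have iu: "integrable (lebesgue_on \<Omega>) (\<lambda>x. (norm (u x))\<^sup>2)"
      by (rule intsup) (use supu smooth_on_continuous[OF u] in
          \<open>auto simp: supported_in_def intro!: continuous_intros\<close>)
    have iG: "integrable (lebesgue_on \<Omega>) (\<lambda>x. (norm (G x))\<^sup>2)"
      by (rule intsup) (use supG contG in \<open>auto simp: supported_in_def intro!: continuous_intros\<close>)
    have sqbound: "(s + t)\<^sup>2 \<le> 2 * s\<^sup>2 + 2 * t\<^sup>2" for s t :: real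
      using sum_squares_bound[of s t] by (simp add: power2_sum)
    \<comment> \<open>the integral on the right of the estimate exists, as \<open>V\<close> is measurable and essentially bounded\<close>
    have ip: "integrable (lebesgue_on \<Omega>) (\<lambda>x. (norm (p x))\<^sup>2)"
    proof (rule Bochner_Integration.integrable_bound)
      show "integrable (lebesgue_on \<Omega>) (\<lambda>x. 2 * h\<^sup>2 * (norm (G x))\<^sup>2 + 2 * h\<^sup>2 * MV\<^sup>2 * (norm (u x))\<^sup>2)"
        using iu iG by simp
      show "(\<lambda>x. (norm (p x))\<^sup>2) \<in> borel_measurable (lebesgue_on \<Omega>)"
      proof (rule norm_square_measurable)
        fix i
        have "(\<lambda>x. V x $ i $ j) \<in> borel_measurable (lebesgue_on \<Omega>)" for j
          using assms(5) by (simp add: Linfty_def)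
        moreover have "(\<lambda>x. u x $ j) \<in> borel_measurable (lebesgue_on \<Omega>)" for j
          using assms(2) smooth_on_continuous[OF u]
          by (intro continuous_imp_measurable_on_sets_lebesgue continuous_intros) auto
        moreover have "(\<lambda>x. G x $ j) \<in> borel_measurable (lebesgue_on \<Omega>)" for j
          using assms(2) contG
          by (intro continuous_imp_measurable_on_sets_lebesgue continuous_intros) auto
        ultimately have "(\<lambda>x. (- \<i> * complex_of_real h) * G x $ i + h *\<^sub>R (\<Sum>j\<in>UNIV. V x $ i $ j * u x $ j))
            \<in> borel_measurable (lebesgue_on \<Omega>)"
          by measurable
        then show "(\<lambda>x. p x $ i) \<in> borel_measurable (lebesgue_on \<Omega>)"
          by (rule measurable_cong[THEN iffD1, rotated]) (simp add: p matrix_vector_mult_def)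
      qed
      show "AE x in lebesgue_on \<Omega>. norm ((norm (p x))\<^sup>2)
          \<le> norm (2 * h\<^sup>2 * (norm (G x))\<^sup>2 + 2 * h\<^sup>2 * MV\<^sup>2 * (norm (u x))\<^sup>2)"
        using MV(2)
      proof (rule AE_mp, intro AE_I2 impI)
        fix x assume x: "x \<in> space (lebesgue_on \<Omega>)" and Vx: "\<forall>w. norm (V x *v w) \<le> MV * norm w"
        have "norm (p x) \<le> norm ((- \<i> * complex_of_real h) *s G x) + norm (h *\<^sub>R (V x *v u x))"
        proof -
          have "x \<in> \<Omega>" using x by simp
          then show ?thesis by (simp only: p norm_triangle_ineq)
        qed
        also have "\<dots> \<le> h * norm (G x) + h * (MV * norm (u x))"
          using h Vx by (simp add: norm_smult_vec norm_mult)
        finally have "(norm (p x))\<^sup>2 \<le> (h * norm (G x) + h * (MV * norm (u x)))\<^sup>2"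
          by (intro power_mono) simp_all
        also have "\<dots> \<le> 2 * (h * norm (G x))\<^sup>2 + 2 * (h * (MV * norm (u x)))\<^sup>2"
          by (rule sqbound)
        finally show "norm ((norm (p x))\<^sup>2)
          \<le> norm (2 * h\<^sup>2 * (norm (G x))\<^sup>2 + 2 * h\<^sup>2 * MV\<^sup>2 * (norm (u x))\<^sup>2)"
          by (simp add: power_mult_distrib)
      qed
    qed
    have Gp: "AE x in lebesgue_on \<Omega>. norm (G x) \<le> norm (p x) / h + MV * norm (u x)"
      using MV(2)
    proof (rule AE_mp, intro AE_I2 impI)
      fix x assume x: "x \<in> space (lebesgue_on \<Omega>)" and Vx: "\<forall>w. norm (V x *v w) \<le> MV * norm w"
      have "h * norm (G x) = norm (p x - h *\<^sub>R (V x *v u x))"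
        using x h by (simp add: p norm_smult_vec norm_mult)
      also have "\<dots> \<le> norm (p x) + norm (h *\<^sub>R (V x *v u x))"
        by (rule norm_triangle_ineq4)
      also have "\<dots> \<le> norm (p x) + h * (MV * norm (u x))"
        using h Vx by simp
      finally show "norm (G x) \<le> norm (p x) / h + MV * norm (u x)"
        using h by (simp add: field_simps)
    qed

    \<comment> \<open>convexification: conjugating by \<open>f\<close> adds \<open>\<kappa> * \<phi> x\<close> to the constant \<open>1 / h\<close>\<close>
    define f where "f x = exp (\<kappa> * (\<phi> x)\<^sup>2 / 2)" for x
    define v where "v x = f x *\<^sub>R u x" for x
    define a where "a x = 1 / h + \<kappa> * \<phi> x" for x
    have smf: "smooth_on \<Omega> f"
    proof -
      have "smooth_on \<Omega> (\<lambda>x. exp ((\<kappa> / 2) * (\<phi> x * \<phi> x)))"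
        by (intro smooth_on_exp smooth_on_mult smooth_on_const assms(2) sm)
      moreover have "f = (\<lambda>x. exp ((\<kappa> / 2) * (\<phi> x * \<phi> x)))"
        by (simp add: f_def fun_eq_iff power2_eq_square)
      ultimately show ?thesis by simp
    qed
    have smv: "smooth_on \<Omega> v"
      unfolding v_def[abs_def] by (intro smooth_on_scaleR assms(2) smf u)
    have sma: "smooth_on \<Omega> a"
      unfolding a_def[abs_def] by (intro smooth_on_add smooth_on_mult smooth_on_const assms(2) sm)
    have supv: "supported_in K v"
      using supu by (simp add: supported_in_def v_def)
    \<comment> \<open>the field is normalized so that \<open>\<phi>\<close> grows along it with unit speed\<close>
    have flow: "flow_deriv a x = \<kappa>" if x: "x \<in> \<Omega>" for x
    proof -
      have "grad a x = \<kappa> *\<^sub>R X x"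
        unfolding a_def[abs_def] X_def
        by (rule grad_chain[where F = "\<lambda>s. 1 / h + \<kappa> * s"])
          (use smooth_on_differentiable[OF sm x] in \<open>auto intro!: derivative_eq_intros\<close>)
      then have "partial k a x = \<kappa> * X x $ k" for k
        by (simp add: grad_def vec_eq_iff)
      then have "flow_deriv a x = \<kappa> * (Y x \<bullet> X x)"
        by (simp add: flow_deriv_def inner_vec_def sum_distrib_left mult_ac)
      then show ?thesis
        using X0[OF x] by (simp add: Y_def inverted_grad_def X_def[symmetric])
    qed
    have dual: "cl (Y x) (cl (X x) w) = w" if "x \<in> \<Omega>" for x w
      using X0[OF that] by (simp add: Y_def inverted_grad_def X_def[symmetric] cl_scaleR cl_cl)
    have fG: "dirac v x - a x *\<^sub>R cl (X x) (v x) = f x *\<^sub>R G x" if x: "x \<in> \<Omega>" for x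
    proof -
      have "grad f x = (f x * \<kappa> * \<phi> x) *\<^sub>R X x"
        unfolding f_def[abs_def] X_def
        by (rule grad_chain[where F = "\<lambda>s. exp (\<kappa> * s\<^sup>2 / 2)"])
          (use smooth_on_differentiable[OF sm x] in \<open>auto intro!: derivative_eq_intros\<close>)
      then have "dirac v x = f x *\<^sub>R dirac u x + (f x * \<kappa> * \<phi> x) *\<^sub>R cl (X x) (u x)"
        unfolding v_def[abs_def]
        using dirac_scaleR[OF smooth_on_differentiable[OF smf x] smooth_on_differentiable[OF u x]]
        by (simp add: cl_scaleR)
      then show ?thesis
        by (simp add: v_def G_def a_def blinfun.scaleR_right algebra_simps)
    qed
    have f1: "1 \<le> f x" and fE: "f x \<le> E" if "x \<in> \<Omega>" for x
    proof -
      show "1 \<le> f x"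
        using \<open>\<kappa> \<ge> 0\<close> by (simp add: f_def)
      have "\<bar>\<phi> x\<bar> \<le> P"
        using P(2)[of x] that closure_subset[of \<Omega>] by auto
      then have "(\<phi> x)\<^sup>2 \<le> P\<^sup>2"
        using P(1) abs_le_square_iff[of "\<phi> x" P] by simp
      then show "f x \<le> E"
        using \<open>\<kappa> \<ge> 0\<close> by (simp add: f_def E_def mult_left_mono)
    qed
    let ?U = "\<integral>x. (norm (u x))\<^sup>2 \<partial>lebesgue_on \<Omega>" and ?V = "\<integral>x. (norm (v x))\<^sup>2 \<partial>lebesgue_on \<Omega>"
      and ?P = "\<integral>x. (norm (p x))\<^sup>2 \<partial>lebesgue_on \<Omega>"
      and ?F = "\<integral>x. (norm (f x *\<^sub>R G x))\<^sup>2 \<partial>lebesgue_on \<Omega>"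
    have iv: "integrable (lebesgue_on \<Omega>) (\<lambda>x. (norm (v x))\<^sup>2)"
      by (rule intsup) (use supv smooth_on_continuous[OF smv] in
          \<open>auto simp: supported_in_def intro!: continuous_intros\<close>)
    have iF: "integrable (lebesgue_on \<Omega>) (\<lambda>x. (norm (f x *\<^sub>R G x))\<^sup>2)"
    proof (rule intsup)
      show "continuous_on \<Omega> (\<lambda>x. (norm (f x *\<^sub>R G x))\<^sup>2)"
        by (intro continuous_intros contG smooth_on_continuous[OF smf])
      show "supported_in K (\<lambda>x. (norm (f x *\<^sub>R G x))\<^sup>2)"
        using supG by (simp add: supported_in_def)
    qed
    have "\<kappa> * ?V \<le> B\<^sup>2 * (\<integral>x. (norm (dirac v x - a x *\<^sub>R cl (X x) (v x)))\<^sup>2 \<partial>lebesgue_on \<Omega>) + (M + M\<^sup>2) * ?V"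
      by (rule carleman_estimate[OF K supv smv sma smX flow dual M(3,1,2)])
    also have "(\<integral>x. (norm (dirac v x - a x *\<^sub>R cl (X x) (v x)))\<^sup>2 \<partial>lebesgue_on \<Omega>) = ?F"
      by (rule Bochner_Integration.integral_cong[OF refl]) (simp add: fG)
    finally have est: "\<kappa> * ?V \<le> B\<^sup>2 * ?F + (M + M\<^sup>2) * ?V" .
    have "?F \<le> (\<integral>x. 2 * E\<^sup>2 / h\<^sup>2 * (norm (p x))\<^sup>2 + 2 * MV\<^sup>2 * (norm (v x))\<^sup>2 \<partial>lebesgue_on \<Omega>)"
    proof (rule integral_mono_AE[OF iF])
      show "integrable (lebesgue_on \<Omega>) (\<lambda>x. 2 * E\<^sup>2 / h\<^sup>2 * (norm (p x))\<^sup>2 + 2 * MV\<^sup>2 * (norm (v x))\<^sup>2)"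
        using ip iv by simp
      show "AE x in lebesgue_on \<Omega>. (norm (f x *\<^sub>R G x))\<^sup>2
          \<le> 2 * E\<^sup>2 / h\<^sup>2 * (norm (p x))\<^sup>2 + 2 * MV\<^sup>2 * (norm (v x))\<^sup>2"
        using Gp
      proof (rule AE_mp, intro AE_I2 impI)
        fix x assume "x \<in> space (lebesgue_on \<Omega>)" and g: "norm (G x) \<le> norm (p x) / h + MV * norm (u x)"
        then have x: "x \<in> \<Omega>" by simp
        have f0: "0 \<le> f x" using f1[OF x] by simp
        have "norm (f x *\<^sub>R G x) \<le> f x * (norm (p x) / h + MV * norm (u x))"
          using f0 g by (simp add: mult_left_mono)
        also have "\<dots> = f x * (norm (p x) / h) + MV * norm (v x)"
          using f0 by (simp add: v_def algebra_simps)
        also have "\<dots> \<le> E * (norm (p x) / h) + MV * norm (v x)"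
          using fE[OF x] h by (intro add_right_mono mult_right_mono) simp_all
        finally have "(norm (f x *\<^sub>R G x))\<^sup>2 \<le> (E * (norm (p x) / h) + MV * norm (v x))\<^sup>2"
          by (intro power_mono) simp_all
        also have "\<dots> \<le> 2 * (E * (norm (p x) / h))\<^sup>2 + 2 * (MV * norm (v x))\<^sup>2"
          by (rule sqbound)
        finally show "(norm (f x *\<^sub>R G x))\<^sup>2 \<le> 2 * E\<^sup>2 / h\<^sup>2 * (norm (p x))\<^sup>2 + 2 * MV\<^sup>2 * (norm (v x))\<^sup>2"
          by (simp add: power_mult_distrib power_divide)
      qed
    qed
    also have "\<dots> = 2 * E\<^sup>2 / h\<^sup>2 * ?P + 2 * MV\<^sup>2 * ?V"
      using ip iv by simp
    finally have "B\<^sup>2 * ?F \<le> B\<^sup>2 * (2 * E\<^sup>2 / h\<^sup>2 * ?P + 2 * MV\<^sup>2 * ?V)"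
      by (rule mult_left_mono) simp
    \<comment> \<open>the coefficient \<open>\<kappa>\<close> on the left beats those of \<open>?V\<close> on the right by exactly 1\<close>
    with est have V: "?V \<le> 2 * B\<^sup>2 * E\<^sup>2 / h\<^sup>2 * ?P"
      by (simp add: \<kappa>_def algebra_simps)
    have "?U \<le> ?V"
    proof (rule integral_mono[OF iu iv])
      fix x assume "x \<in> space (lebesgue_on \<Omega>)"
      then have "1 \<le> f x" using f1 by simp
      then have "1 * norm (u x) \<le> norm (v x)"
        unfolding v_def norm_scaleR by (intro mult_right_mono) auto
      then show "(norm (u x))\<^sup>2 \<le> (norm (v x))\<^sup>2"
        by (intro power_mono) simp_all
    qed
    then have "h\<^sup>2 * ?U \<le> h\<^sup>2 * (2 * B\<^sup>2 * E\<^sup>2 / h\<^sup>2 * ?P)"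
      using V by (intro mult_left_mono) auto
    then have U: "h\<^sup>2 * ?U \<le> c1\<^sup>2 * ?P"
      using h by (simp add: c1_def power_mult_distrib)
    have c1: "0 \<le> c1"
      using B(1) by (simp add: c1_def E_def)
    have first: "h * L2norm \<Omega> u \<le> c1 * L2norm \<Omega> p"
      using real_sqrt_le_mono[OF U] h c1 by (simp add: L2norm_def real_sqrt_mult)

    \<comment> \<open>the gradient: \<open>h *\<^sub>R dirac u x\<close> is \<open>h *\<^sub>R G x\<close> plus a bounded multiple of \<open>u x\<close>\<close>
    have iD: "integrable (lebesgue_on \<Omega>) (\<lambda>x. (norm (dirac u x))\<^sup>2)"
      by (rule intsup) (use supported_in_dirac[OF K(1) supu] smooth_on_continuous[OF smooth_on_dirac[OF assms(2) u]]
          in \<open>auto simp: supported_in_def intro!: continuous_intros\<close>)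
    have "(\<integral>x. h\<^sup>2 * (norm (dirac u x))\<^sup>2 \<partial>lebesgue_on \<Omega>)
        \<le> (\<integral>x. 2 * (norm (p x))\<^sup>2 + 2 * (L + MV)\<^sup>2 * (norm (u x))\<^sup>2 \<partial>lebesgue_on \<Omega>)"
    proof (rule integral_mono_AE)
      show "integrable (lebesgue_on \<Omega>) (\<lambda>x. h\<^sup>2 * (norm (dirac u x))\<^sup>2)"
        "integrable (lebesgue_on \<Omega>) (\<lambda>x. 2 * (norm (p x))\<^sup>2 + 2 * (L + MV)\<^sup>2 * (norm (u x))\<^sup>2)"
        using iD ip iu by simp_all
      show "AE x in lebesgue_on \<Omega>. h\<^sup>2 * (norm (dirac u x))\<^sup>2
          \<le> 2 * (norm (p x))\<^sup>2 + 2 * (L + MV)\<^sup>2 * (norm (u x))\<^sup>2"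
        using Gp
      proof (rule AE_mp, intro AE_I2 impI)
        fix x assume "x \<in> space (lebesgue_on \<Omega>)" and g: "norm (G x) \<le> norm (p x) / h + MV * norm (u x)"
        then have x: "x \<in> closure \<Omega>" using closure_subset by auto
        have "h * norm (dirac u x) = norm (h *\<^sub>R G x + cl (X x) (u x))"
          using h by (simp add: G_def scaleR_diff_right)
        also have "\<dots> \<le> norm (h *\<^sub>R G x) + norm (cl (X x) (u x))"
          by (rule norm_triangle_ineq)
        also have "\<dots> \<le> h * (norm (p x) / h + MV * norm (u x)) + L * norm (u x)"
          unfolding norm_cl using h g L(2)[OF x] by (intro add_mono mult_right_mono) simp_all
        also have "\<dots> = norm (p x) + h * (MV * norm (u x)) + L * norm (u x)"
          using h by (simp add: distrib_left)
        also have "\<dots> \<le> norm (p x) + (L + MV) * norm (u x)"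
          using h MV(1) mult_right_mono[of h 1 "MV * norm (u x)"] by (simp add: algebra_simps)
        finally have "(h * norm (dirac u x))\<^sup>2 \<le> (norm (p x) + (L + MV) * norm (u x))\<^sup>2"
          using h by (intro power_mono) simp_all
        also have "\<dots> \<le> 2 * (norm (p x))\<^sup>2 + 2 * ((L + MV) * norm (u x))\<^sup>2"
          by (rule sqbound)
        finally show "h\<^sup>2 * (norm (dirac u x))\<^sup>2 \<le> 2 * (norm (p x))\<^sup>2 + 2 * (L + MV)\<^sup>2 * (norm (u x))\<^sup>2"
          by (simp add: power_mult_distrib)
      qed
    qed
    then have "h\<^sup>2 * (\<integral>x. (norm (grad u x))\<^sup>2 \<partial>lebesgue_on \<Omega>) \<le> 2 * ?P + 2 * (L + MV)\<^sup>2 * ?U"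
      using iD ip iu by (simp add: integral_norm_grad_eq_dirac[OF assms(2) K supu u])
    then have "h\<^sup>2 * (h\<^sup>2 * (\<integral>x. (norm (grad u x))\<^sup>2 \<partial>lebesgue_on \<Omega>)) \<le> h\<^sup>2 * (2 * ?P + 2 * (L + MV)\<^sup>2 * ?U)"
      by (rule mult_left_mono) simp
    also have "\<dots> = h\<^sup>2 * (2 * ?P) + 2 * (L + MV)\<^sup>2 * (h\<^sup>2 * ?U)"
      by (simp add: algebra_simps)
    also have "\<dots> \<le> 1 * (2 * ?P) + 2 * (L + MV)\<^sup>2 * (c1\<^sup>2 * ?P)"
      using h U by (intro add_mono mult_right_mono mult_left_mono power_le_one) simp_all
    also have "\<dots> = c2\<^sup>2 * ?P"
      by (simp add: c2_def add_nonneg_nonneg algebra_simps)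
    finally have g: "(h\<^sup>2)\<^sup>2 * (\<integral>x. (norm (grad u x))\<^sup>2 \<partial>lebesgue_on \<Omega>) \<le> c2\<^sup>2 * ?P"
      by (simp add: power2_eq_square[of "h\<^sup>2"] mult.assoc)
    have "0 \<le> c2"
      by (simp add: c2_def add_nonneg_nonneg)
    then have "h\<^sup>2 * L2norm \<Omega> (grad u) \<le> c2 * L2norm \<Omega> p"
      using real_sqrt_le_mono[OF g] unfolding L2norm_def real_sqrt_mult real_sqrt_abs by simp
    with first show ?thesis
      by (simp add: p_def)
  qed
  have "0 < c1 + c2"
    using B(1) by (simp add: c1_def c2_def E_def add_pos_nonneg add_nonneg_nonneg)
  moreover have "h * L2norm \<Omega> u + h\<^sup>2 * L2norm \<Omega> (grad u)
      \<le> (c1 + c2) * L2norm \<Omega> (conjugated_op A V \<phi> h u)"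
    if "0 < h \<and> h \<le> 1" "u \<in> test_functions \<Omega>" for h and u :: "real^'n \<Rightarrow> complex^'N"
    using main[of h u] that by (simp add: distrib_right)
  ultimately show ?thesis
    by (intro exI[of _ 1] conjI exI[of _ "c1 + c2"]) auto
qed

end
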